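(* Let $(X,Y)=(X_n,Y_n)_{n\in\mathbb{T}}$, $\mathbb{T}=\{0,-1,-2,\dots\}$, be the hidden Markov model on $(\Omega,\mathcal{F},\mathbf{P})$ described in the context, with conditional kernels $M^y=(M_n^y)_{n\in\mathbb{T}}$ and coupling objects $\mathbf{Q}^y$, $\Phi_{n,k}$, $T_n$. Fix any $y\in\Omega^Y$. Any (and all) of the following equivalent conditions 1. for all $k\in\mathbb{T}$ and $(x,x',z)\in E^3$, $\lim_{n\to-\infty}\big(M^y_{n,k}(x,z)-M^y_{n,k}(x',z)\big)=0$; 2. $\mathrm{card}(\Pi_{M^y})=1$; 3. for all $k\in\mathbb{T}$, $\lim_{n\to-\infty}\beta(M^y_{n,k})=0$; 4. there exists a strictly decreasing sequence $(n_i)_{i\in\mathbb{N}}$ in $\mathbb{T}$ such that $\sum_{i=0}^\infty\big(1-\beta(M^y_{n_{i+1},n_i})\big)=\infty$ hold if and only if $$\mathbf{Q}^y(T_n>-\infty)=1\quad\text{for all }n\in\mathbb{T}.\qquad( * )$$ Furthermore, if $( * )$ holds then for all $n\in\mathbb{T}$ and $x\in E$, $\mathbf{Q}^y(\Phi_{T_n,n}(x)\in\cdot\,)=\pi_n^y(\cdot)$, where $\pi^y=(\pi^y_n)_{n\in\mathbb{T}}$ is the unique sequence of absolute probabilities for $M^y$. If $( * )$ holds for all $y$ in a set of $\mathbf{P}\circ Y^{-1}$-probability $1$, then for all $n\in\mathbb{T}$ and $x\in E$, $\mathbf{Q}^Y(\Phi_{T_n,n}(x)\in\cdot\,)=\mathbf{P}(X_n\in\cdot\,|\mathcal{F}^Y)$,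 $\mathbf{P}$-a.s.
   Context: Absolute probabilities: for a sequence $K=(K_n)_{n\in\mathbb{T}}$ of Markov kernels on $E$, a sequence of absolute probabilities is a family $(\pi_n)_{n\in\mathbb{T}}$ of probability distributions on $E$ with $\sum_{z}\pi_{n-1}(z)K_n(z,x)=\pi_n(x)$ for all $n\in\mathbb{T}$, $x\in E$; $\Pi_K$ is the (always non-empty) set of all such families. Dobrushin's coefficient: $\beta(K)=\max_{x,x'\in E}\frac12\sum_{z\in E}|K(x,z)-K(x',z)|$ for a Markov kernel $K$ on $E$. Model: $E=\{1,\dots,s\}$ is finite; $F$ is a non-empty Polish space with Borel $\sigma$-algebra $\mathcal{B}(F)$; $\Omega^X=E^{\mathbb{T}}$, $\Omega^Y=F^{\mathbb{T}}$ with product $\sigma$-algebras; $\Omega=\Omega^X\times\Omega^Y$ with Borel $\sigma$-algebra $\mathcal{F}$; $X_n(x,y)=x_n$, $Y_n(x,y)=y_n$; $X=(X_n)_{n\in\mathbb{T}}$, $Y=(Y_n)_{n\in\mathbb{T}}$; $\mathcal{F}^Y=\sigma(Y_n;n\in\mathbb{T})$. $M=(M_n)_{n\in\mathbb{T}}$ are Markov kernels on $E$, $G_n(x,dy)=g_n(x,y)\psi(dy)$, $n\in\mathbb{T}$, are probability kernels from $E$ to $F$ with $g_n:E\times F\to[0,\infty[$ and $\psi$ a $\sigma$-finite measure on $F$, and $\pi\in\Pi_M$ is fixed. $\mathbf{P}$ is the probability measure on $(\Omega,\mathcal{F})$ under which, for each $n\in\mathbb{T}$, $(X_n,Y_n,\dots,X_0,Y_0)$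 has law $\pi_n(dx_n)G_n(x_n,dy_n)\prod_{k=n+1}^0M_k(x_{k-1},dx_k)G_k(x_k,dy_k)$. $\mathbf{P}\circ Y^{-1}$ is the law of $Y$ under $\mathbf{P}$. Conditional kernels: let $\phi_1\equiv1$ and, for $n\in\mathbb{T}$, $\phi_n(x,y_{n:0})=\sum_{x'\in E}M_n(x,x')g_n(x',y_n)\phi_{n+1}(x',y_{n+1:0})$, where $y_{n:0}=(y_n,\dots,y_0)$. For $y\in\Omega^Y$, $M_n^y(x,x')=M_n(x,x')g_n(x',y_n)\phi_{n+1}(x',y_{n+1:0})/\phi_n(x,y_{n:0})$ if $\phi_n(x,y_{n:0})>0$, and $M_n^y(x,x')=M_n(x,x')$ if $\phi_n(x,y_{n:0})=0$. Backward products: $M^y_{k,k}=Id$, $M^y_{n-1,k}=M^y_nM^y_{n,k}$ for $n\le k$, i.e. $M^y_{n,k}=M^y_{n+1}\cdots M^y_k$ for $n<k$. That conditions 1-4 are mutually equivalent is a classical fact. Coupling: on $(E^s)^{\mathbb{T}}$ with product $\sigma$-algebra and coordinates $(\xi_n^x;x\in E,n\in\mathbb{T})$, $\mathbf{Q}^y$ (a probability kernel in $y\in\Omega^Y$) makes all $\xi_n^x$ independent with $\mathbf{Q}^y(\xi_n^x=x')=M_n^y(x,x')$. $\Phi_n(x)=\xi_n^x$; $\Phi_{n,k}=\Phi_k\circ\cdots\circ\Phi_{n+1}$ for $n<k$; $T_k=\sup\{n<k:\text{image of }\Phi_{n,k}\text{ is a singleton}\}$, with $T_k=-\infty$ if this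 set is empty. *)

theory Defs
  imports "HOL-Probability.Probability" "HOL-Library.Extended"
begin

text \<open>
  The time set \<open>{0, -1, -2, \<dots>}\<close> is \<open>{..0} :: int set\<close>, and the state space \<open>E\<close> is a type
  of class \<open>finite\<close>.  Kernels on \<open>E\<close> are matrices \<open>'e \<Rightarrow> 'e \<Rightarrow> real\<close>; for a family \<open>K\<close> of
  kernels, \<open>K n\<close> describes the transition from time \<open>n - 1\<close> to time \<open>n\<close>.
\<close>

definition prob_vector :: "('e::finite \<Rightarrow> real) \<Rightarrow> bool" where
  "prob_vector p \<longleftrightarrow> (\<forall>x. 0 \<le> p x) \<and> (\<Sum>x\<in>UNIV. p x) = 1"

definition markov_kernel :: "('e::finite \<Rightarrow> 'e \<Rightarrow> real) \<Rightarrow> bool" where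
  "markov_kernel K \<longleftrightarrow> (\<forall>x. prob_vector (K x))"

definition kernel_id :: "'e \<Rightarrow> 'e \<Rightarrow> real" where
  "kernel_id x x' = (if x = x' then 1 else 0)"

definition kernel_mult ::
    "('e::finite \<Rightarrow> 'e \<Rightarrow> real) \<Rightarrow> ('e \<Rightarrow> 'e \<Rightarrow> real) \<Rightarrow> 'e \<Rightarrow> 'e \<Rightarrow> real" where
  "kernel_mult A B x z = (\<Sum>u\<in>UNIV. A x u * B u z)"

text \<open>\<open>backward_prod K n k\<close> is \<open>K\<^sub>n\<^sub>+\<^sub>1 \<cdots> K\<^sub>k\<close> for \<open>n < k\<close>; the two lemmas below are its recursion.\<close>

definition backward_prod ::
    "(int \<Rightarrow> 'e::finite \<Rightarrow> 'e \<Rightarrow> real) \<Rightarrow> int \<Rightarrow> int \<Rightarrow> 'e \<Rightarrow> 'e \<Rightarrow> real" where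
  "backward_prod K n k = foldr (\<lambda>j. kernel_mult (K j)) [n + 1..k] kernel_id"

lemma backward_prod_refl: "backward_prod K k k = kernel_id"
  by (simp add: backward_prod_def)

lemma backward_prod_step:
  "n \<le> k \<Longrightarrow> backward_prod K (n - 1) k = kernel_mult (K n) (backward_prod K n k)"
  by (simp add: backward_prod_def upto_rec1)

definition dobrushin :: "('e::finite \<Rightarrow> 'e \<Rightarrow> real) \<Rightarrow> real" where
  "dobrushin K = Max (range (\<lambda>(x, x'). 1 / 2 * (\<Sum>z\<in>UNIV. \<bar>K x z - K x' z\<bar>)))"

text \<open>
  Families over the time set are required to be extensional (equal to \<^const>\<open>undefined\<close> at
  positive integers), so that the cardinality of \<open>absolute_probs K\<close> is the intended one.
\<close>

definition absolute_probs ::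
    "(int \<Rightarrow> 'e::finite \<Rightarrow> 'e \<Rightarrow> real) \<Rightarrow> (int \<Rightarrow> 'e \<Rightarrow> real) set" where
  "absolute_probs K = {\<pi> \<in> extensional {..0}.
     (\<forall>n\<le>0. prob_vector (\<pi> n)) \<and>
     (\<forall>n\<le>0. \<forall>x. (\<Sum>z\<in>UNIV. \<pi> (n - 1) z * K n z x) = \<pi> n x)}"

definition path_X :: "(int \<Rightarrow> 'e) measure" where
  "path_X = (\<Pi>\<^sub>M n\<in>{..0}. count_space UNIV)"

definition path_Y :: "(int \<Rightarrow> 'f::polish_space) measure" where
  "path_Y = (\<Pi>\<^sub>M n\<in>{..0}. borel)"

definition coord_X :: "int \<Rightarrow> (int \<Rightarrow> 'e) \<times> (int \<Rightarrow> 'f) \<Rightarrow> 'e" where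
  "coord_X n \<omega> = fst \<omega> n"

definition coord_Y :: "int \<Rightarrow> (int \<Rightarrow> 'e) \<times> (int \<Rightarrow> 'f) \<Rightarrow> 'f" where
  "coord_Y n \<omega> = snd \<omega> n"

definition sigma_Y ::
    "((int \<Rightarrow> 'e) \<times> (int \<Rightarrow> 'f::polish_space)) measure
      \<Rightarrow> ((int \<Rightarrow> 'e) \<times> (int \<Rightarrow> 'f)) measure" where
  "sigma_Y P = sigma (space P) {coord_Y n -` B \<inter> space P | n B. n \<le> 0 \<and> B \<in> sets borel}"

text \<open>
  Joint law of \<open>(X\<^sub>k, Y\<^sub>k)\<close>, \<open>k = n, \<dots>, 0\<close>: since \<open>G\<^sub>k(x, dy) = g\<^sub>k(x, y) \<psi>(dy)\<close> and \<open>E\<close> is finite,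
  the iterated kernel \<open>\<pi>\<^sub>n(dx\<^sub>n) G\<^sub>n(x\<^sub>n, dy\<^sub>n) \<Prod>\<^sub>k M\<^sub>k(x\<^sub>k\<^sub>-\<^sub>1, dx\<^sub>k) G\<^sub>k(x\<^sub>k, dy\<^sub>k)\<close> is given by its
  density with respect to the product of copies of counting measure times \<open>\<psi>\<close>.
\<close>

definition hmm_law ::
    "(int \<Rightarrow> 'e::finite \<Rightarrow> 'e \<Rightarrow> real) \<Rightarrow> (int \<Rightarrow> 'e \<Rightarrow> 'f \<Rightarrow> real) \<Rightarrow> 'f measure
      \<Rightarrow> (int \<Rightarrow> 'e \<Rightarrow> real) \<Rightarrow> int \<Rightarrow> (int \<Rightarrow> 'e \<times> 'f) measure" where
  "hmm_law M g \<psi> \<pi> n =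
     density (\<Pi>\<^sub>M k\<in>{n..0}. count_space UNIV \<Otimes>\<^sub>M \<psi>)
       (\<lambda>w. ennreal (\<pi> n (fst (w n)) * g n (fst (w n)) (snd (w n)) *
          (\<Prod>k\<in>{n + 1..0}. M k (fst (w (k - 1))) (fst (w k)) * g k (fst (w k)) (snd (w k)))))"

definition hmm_measure ::
    "(int \<Rightarrow> 'e::finite \<Rightarrow> 'e \<Rightarrow> real) \<Rightarrow> (int \<Rightarrow> 'e \<Rightarrow> 'f::polish_space \<Rightarrow> real) \<Rightarrow> 'f measure
      \<Rightarrow> (int \<Rightarrow> 'e \<Rightarrow> real) \<Rightarrow> ((int \<Rightarrow> 'e) \<times> (int \<Rightarrow> 'f)) measure \<Rightarrow> bool" where
  "hmm_measure M g \<psi> \<pi> P \<longleftrightarrow>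
     prob_space P \<and> sets P = sets (path_X \<Otimes>\<^sub>M path_Y) \<and>
     (\<forall>n\<le>0. distr P (\<Pi>\<^sub>M k\<in>{n..0}. count_space UNIV \<Otimes>\<^sub>M borel)
               (\<lambda>\<omega>. \<lambda>k\<in>{n..0}. (coord_X k \<omega>, coord_Y k \<omega>)) = hmm_law M g \<psi> \<pi> n)"

text \<open>\<open>phi M g y n x\<close> is \<open>\<phi>\<^sub>n(x, y\<^sub>n, \<dots>, y\<^sub>0)\<close>, defined for \<open>n \<le> 1\<close> by the recursion below.\<close>

definition phi ::
    "(int \<Rightarrow> 'e::finite \<Rightarrow> 'e \<Rightarrow> real) \<Rightarrow> (int \<Rightarrow> 'e \<Rightarrow> 'f \<Rightarrow> real) \<Rightarrow> (int \<Rightarrow> 'f)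
      \<Rightarrow> int \<Rightarrow> 'e \<Rightarrow> real" where
  "phi M g y n =
     foldr (\<lambda>k h x. \<Sum>x'\<in>UNIV. M k x x' * g k x' (y k) * h x') [n..0] (\<lambda>_. 1)"

lemma phi_1: "phi M g y 1 x = 1"
  by (simp add: phi_def)

lemma phi_step:
  "n \<le> 0 \<Longrightarrow> phi M g y n x = (\<Sum>x'\<in>UNIV. M n x x' * g n x' (y n) * phi M g y (n + 1) x')"
  by (simp add: phi_def upto_rec1)

definition cond_kernel ::
    "(int \<Rightarrow> 'e::finite \<Rightarrow> 'e \<Rightarrow> real) \<Rightarrow> (int \<Rightarrow> 'e \<Rightarrow> 'f \<Rightarrow> real) \<Rightarrow> (int \<Rightarrow> 'f)
      \<Rightarrow> int \<Rightarrow> 'e \<Rightarrow> 'e \<Rightarrow> real" where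
  "cond_kernel M g y n x x' =
     (if phi M g y n x > 0
      then M n x x' * g n x' (y n) * phi M g y (n + 1) x' / phi M g y n x
      else M n x x')"

text \<open>
  A point \<open>\<xi>\<close> of the coupling space has coordinates \<open>\<xi> n x\<close>, so the random map \<open>\<Phi>\<^sub>n\<close>
  is \<open>\<xi> n\<close> itself.
\<close>

definition coupling_space :: "(int \<Rightarrow> 'e \<Rightarrow> 'e) measure" where
  "coupling_space = (\<Pi>\<^sub>M n\<in>{..0}. \<Pi>\<^sub>M x\<in>UNIV. count_space UNIV)"

definition coupling_kernel ::
    "(int \<Rightarrow> 'e::finite \<Rightarrow> 'e \<Rightarrow> real) \<Rightarrow> (int \<Rightarrow> 'e \<Rightarrow> 'f::polish_space \<Rightarrow> real)
      \<Rightarrow> ((int \<Rightarrow> 'f) \<Rightarrow> (int \<Rightarrow> 'e \<Rightarrow> 'e) measure) \<Rightarrow> bool" where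
  "coupling_kernel M g Q \<longleftrightarrow>
     Q \<in> measurable path_Y (prob_algebra coupling_space) \<and>
     (\<forall>y\<in>space path_Y.
        prob_space.indep_vars (Q y) (\<lambda>_. count_space UNIV) (\<lambda>(n, x) \<xi>. \<xi> n x) ({..0} \<times> UNIV) \<and>
        (\<forall>n\<le>0. \<forall>x x'. \<P>(\<xi> in Q y. \<xi> n x = x') = cond_kernel M g y n x x'))"

text \<open>\<open>flow \<xi> n k = \<xi> k \<circ> \<cdots> \<circ> \<xi> (n + 1)\<close>, since \<^const>\<open>fold\<close> applies the head of the list first.\<close>

definition flow :: "(int \<Rightarrow> 'e \<Rightarrow> 'e) \<Rightarrow> int \<Rightarrow> int \<Rightarrow> 'e \<Rightarrow> 'e" where
  "flow \<xi> n k = fold \<xi> [n + 1..k]"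

lemma flow_refl: "flow \<xi> k k = id"
  by (simp add: flow_def id_def)

lemma flow_step: "n \<le> k \<Longrightarrow> flow \<xi> n (k + 1) = \<xi> (k + 1) \<circ> flow \<xi> n k"
  by (simp add: flow_def upto_rec2)

text \<open>The set of coalescence times is bounded above by \<open>k\<close>, so \<open>Sup\<close> on \<open>int\<close> is meaningful.\<close>

definition coal_time :: "int \<Rightarrow> (int \<Rightarrow> 'e \<Rightarrow> 'e) \<Rightarrow> int extended" where
  "coal_time k \<xi> =
     (let S = {n. n < k \<and> is_singleton (range (flow \<xi> n k))}
      in if S = {} then Minf else Fin (Sup S))"

text \<open>
  The map \<open>\<Phi>\<^bsub>T\<^sub>k,k\<^esub>\<close>.  Its value on the event \<open>T\<^sub>k = -\<infinity>\<close>, where the expression is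
  undefined, is an arbitrary convention (\<open>T\<^sub>k\<close> is never \<^const>\<open>Pinf\<close>).
\<close>

definition coal_map :: "int \<Rightarrow> (int \<Rightarrow> 'e \<Rightarrow> 'e) \<Rightarrow> 'e \<Rightarrow> 'e" where
  "coal_map k \<xi> = (case coal_time k \<xi> of Fin m \<Rightarrow> flow \<xi> m k | _ \<Rightarrow> id)"

definition coalescence :: "(int \<Rightarrow> 'e \<Rightarrow> 'e) measure \<Rightarrow> bool" where
  "coalescence R \<longleftrightarrow> (\<forall>n\<le>0. \<P>(\<xi> in R. coal_time n \<xi> > Minf) = 1)"

end

theory Submission
  imports Defs "HOL-Complex_Analysis.Great_Picard"
begin

text \<open>
  Fix the observations \<open>y\<close>, and write \<open>K\<close> for the conditional kernels and \<open>K\<^sub>n\<^sub>,\<^sub>k\<close> for their product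
  over \<open>(n, k]\<close>.  Everything is tied to one property, \<open>rows_merge K\<close>: the rows of \<open>K\<^sub>n\<^sub>,\<^sub>k\<close> become
  equal as \<open>n\<close> tends to \<open>-\<infinity>\<close>.

  For the deterministic conditions, Dobrushin's coefficient is submultiplicative
  (\<open>dobrushin_mult\<close>), so a divergent sum of \<open>1 - \<beta>\<close> over consecutive blocks forces the product of
  the coefficients to zero, while merging rows allow a choice of blocks that each contribute
  at least \<open>1/2\<close>.  Any sequence of absolute probabilities is an average of rows of \<open>K\<^sub>n\<^sub>,\<^sub>k\<close>, so if the
  rows merge it is their limit and is unique (\<open>absolute_probs_limit\<close>).  Conversely, every
  subsequential limit of rows is a sequence of absolute probabilities
  (\<open>absolute_probs_subsequence\<close>), so rows that stay apart produce two different ones.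

  For the coupling, \<open>K\<^sub>n\<^sub>,\<^sub>k(x, \<cdot>)\<close> is the law of \<open>\<Phi>\<^sub>n\<^sub>,\<^sub>k(x)\<close>.  If coalescence is certain, then
  \<open>\<Phi>\<^sub>n\<^sub>,\<^sub>k\<close> is constant with probability tending to one, and the rows merge.  Conversely, trajectories
  that stick together when they meet are at a common state \<open>z\<close> at least as often as independent ones:
  all of \<open>E\<close> is sent to \<open>z\<close> with probability at least \<open>\<Prod>\<^sub>x K\<^sub>n\<^sub>,\<^sub>k(x, z)\<close> (\<open>prob_flow_joint_ge\<close>).
  If the rows are close to each other, this product is bounded below for a suitable \<open>z\<close> by a constant
  that depends on the number of states only.  Disjoint blocks of time are independent, so one of them
  coalesces almost surely.  The value after coalescence is the value of \<open>\<Phi>\<^sub>n\<^sub>,\<^sub>k(x)\<close> for all \<open>n\<close> far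
  enough in the past, hence its law is the limit of the rows (\<open>prob_coal_map\<close>).

  For the hidden Markov model, the conditional law of \<open>X\<^sub>n\<close> given all observations satisfies
  \<open>P(X\<^sub>n = z | Y) = E(K\<^sub>n(X\<^sub>n\<^sub>-\<^sub>1, z) | Y)\<close> with \<open>K\<close> now formed from the random \<open>Y\<close>.  On events that depend on
  finitely many observations this is an identity between two sums over paths, for each fixed value of
  the observations: summing out the states after time \<open>n\<close> produces exactly the functions \<open>\<phi>\<close> from
  which \<open>K\<close> is built (\<open>path_sum_cond_kernel\<close>).  Almost surely, therefore, the conditional laws form a
  sequence of absolute probabilities for \<open>K\<close> (\<open>smoothed_absolute_probs\<close>), and where that sequence is
  unique it is the law produced by the coupling.
\<close>


section \<open>Products of Markov kernels\<close>

lemma kernel_mult_id_left [simp]: "kernel_mult kernel_id A = A"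
  by (intro ext) (simp add: kernel_mult_def kernel_id_def if_distrib[of "\<lambda>c. c * _"] cong: if_cong)

lemma kernel_mult_assoc: "kernel_mult (kernel_mult A B) C = kernel_mult A (kernel_mult B C)"
  unfolding kernel_mult_def
  by (intro ext, simp add: sum_distrib_left sum_distrib_right mult.assoc) (rule sum.swap)

lemma backward_prod_comp:
  assumes "n \<le> m" "m \<le> k"
  shows "backward_prod K n k = kernel_mult (backward_prod K n m) (backward_prod K m k)"
  using assms(1)
proof (induction n rule: int_le_induct)
  case base
  then show ?case by (simp add: backward_prod_refl)
next
  case (step i)
  then show ?case using assms by (simp add: backward_prod_step kernel_mult_assoc)
qed

lemma markov_kernelD:
  assumes "markov_kernel K"
  shows "0 \<le> K x z" "(\<Sum>z\<in>UNIV. K x z) = 1" "K x z \<le> 1"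
proof -
  show *: "0 \<le> K x z" "(\<Sum>z\<in>UNIV. K x z) = 1" for x z
    using assms by (auto simp: markov_kernel_def prob_vector_def)
  show "K x z \<le> 1"
    using member_le_sum[of z UNIV "K x"] * by auto
qed

lemma markov_kernel_id: "markov_kernel kernel_id"
  by (auto simp: markov_kernel_def prob_vector_def kernel_id_def)

lemma markov_kernel_mult:
  assumes "markov_kernel A" "markov_kernel B"
  shows "markov_kernel (kernel_mult A B)"
proof -
  have "(\<Sum>z\<in>UNIV. \<Sum>u\<in>UNIV. A x u * B u z) = 1" for x
    using markov_kernelD(2)[OF assms(1)] markov_kernelD(2)[OF assms(2)]
    by (subst sum.swap) (simp flip: sum_distrib_left)
  then show ?thesis
    using markov_kernelD(1)[OF assms(1)] markov_kernelD(1)[OF assms(2)]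
    by (auto simp: markov_kernel_def prob_vector_def kernel_mult_def intro!: sum_nonneg)
qed

lemma markov_backward_prod:
  assumes "\<forall>n\<le>0. markov_kernel (K n)" "n \<le> k" "k \<le> 0"
  shows "markov_kernel (backward_prod K n k)"
  using assms(2)
proof (induction n rule: int_le_induct)
  case base
  then show ?case by (simp add: backward_prod_refl markov_kernel_id)
next
  case (step i)
  then show ?case using assms by (simp add: backward_prod_step markov_kernel_mult)
qed

section \<open>Dobrushin's coefficient\<close>

lemma dobrushin_upper: "1 / 2 * (\<Sum>z\<in>UNIV. \<bar>K x z - K x' z\<bar>) \<le> dobrushin K"
  unfolding dobrushin_def by (intro Max_ge) auto

lemma dobrushin_least:
  assumes "\<And>x x'. 1 / 2 * (\<Sum>z\<in>UNIV. \<bar>K x z - K x' z\<bar>) \<le> c"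
  shows "dobrushin K \<le> c"
  unfolding dobrushin_def using assms by (subst Max_le_iff) auto

lemma dobrushin_nonneg: "0 \<le> dobrushin K"
  using dobrushin_upper[of K undefined undefined] by simp

lemma abs_diff_le_dobrushin: "\<bar>K x z - K x' z\<bar> \<le> 2 * dobrushin K"
  using dobrushin_upper[of K x x'] member_le_sum[of z UNIV "\<lambda>z. \<bar>K x z - K x' z\<bar>"] by simp

lemma dobrushin_le_1:
  assumes "markov_kernel K"
  shows "dobrushin K \<le> 1"
proof (rule dobrushin_least)
  fix x x'
  have "(\<Sum>z\<in>UNIV. \<bar>K x z - K x' z\<bar>) \<le> (\<Sum>z\<in>UNIV. K x z + K x' z)"
    using markov_kernelD(1)[OF assms] by (intro sum_mono) (smt (verit))
  also have "\<dots> = 2"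
    using markov_kernelD(2)[OF assms] by (simp add: sum.distrib)
  finally show "1 / 2 * (\<Sum>z\<in>UNIV. \<bar>K x z - K x' z\<bar>) \<le> 1"
    by simp
qed

text \<open>
  A signed measure of total mass zero is a positive combination of differences of point masses: the positive
  part is transported onto the negative part by the product coupling.  For a difference of point
  masses the bound is the definition of the coefficient.
\<close>

lemma sum_abs_kernel_le_dobrushin:
  fixes d :: "'e::finite \<Rightarrow> real"
  assumes "(\<Sum>u\<in>UNIV. d u) = 0"
  shows "(\<Sum>z\<in>UNIV. \<bar>\<Sum>u\<in>UNIV. d u * B u z\<bar>) \<le> dobrushin B * (\<Sum>u\<in>UNIV. \<bar>d u\<bar>)"
proof (cases "\<forall>u. d u = 0")
  case True
  then show ?thesis by simp
next
  case False
  define p where "p u = max (d u) 0" for u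
  define q where "q u = max (- d u) 0" for u
  define t where "t = (\<Sum>u\<in>UNIV. p u)"
  have d: "d u = p u - q u" "\<bar>d u\<bar> = p u + q u" "0 \<le> p u" "0 \<le> q u" for u
    by (auto simp: p_def q_def)
  have q: "(\<Sum>u\<in>UNIV. q u) = t"
    using assms by (simp add: d(1) t_def sum_subtractf)
  have t2: "(\<Sum>u\<in>UNIV. \<bar>d u\<bar>) = 2 * t"
    by (simp add: d(2) sum.distrib q t_def)
  have "(\<Sum>u\<in>UNIV. \<bar>d u\<bar>) > 0"
    using False by (auto intro: sum_pos2)
  then have t: "t > 0" using t2 by simp
  have eq: "t * (\<Sum>u\<in>UNIV. d u * B u z) = (\<Sum>u\<in>UNIV. \<Sum>v\<in>UNIV. p u * q v * (B u z - B v z))" for z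
  proof -
    have "(\<Sum>u\<in>UNIV. \<Sum>v\<in>UNIV. p u * q v * (B u z - B v z))
        = (\<Sum>u\<in>UNIV. \<Sum>v\<in>UNIV. (p u * B u z) * q v) - (\<Sum>u\<in>UNIV. \<Sum>v\<in>UNIV. p u * (q v * B v z))"
      by (simp add: algebra_simps sum_subtractf)
    also have "\<dots> = (\<Sum>u\<in>UNIV. p u * B u z) * t - t * (\<Sum>v\<in>UNIV. q v * B v z)"
      by (simp add: q t_def flip: sum_product)
    finally show ?thesis
      by (simp add: d(1) algebra_simps sum_subtractf)
  qed
  have "t * (\<Sum>z\<in>UNIV. \<bar>\<Sum>u\<in>UNIV. d u * B u z\<bar>)
      = (\<Sum>z\<in>UNIV. \<bar>\<Sum>u\<in>UNIV. \<Sum>v\<in>UNIV. p u * q v * (B u z - B v z)\<bar>)"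
    unfolding eq[symmetric] abs_mult using t by (simp add: sum_distrib_left)
  also have "\<dots> \<le> (\<Sum>z\<in>UNIV. \<Sum>u\<in>UNIV. \<Sum>v\<in>UNIV. p u * q v * \<bar>B u z - B v z\<bar>)"
    using d(3,4) by (intro sum_mono order_trans[OF sum_abs] sum_mono) (auto simp: abs_mult)
  also have "\<dots> = (\<Sum>u\<in>UNIV. \<Sum>v\<in>UNIV. p u * q v * (\<Sum>z\<in>UNIV. \<bar>B u z - B v z\<bar>))"
  proof -
    have "(\<Sum>z\<in>UNIV. \<Sum>u\<in>UNIV. \<Sum>v\<in>UNIV. p u * q v * \<bar>B u z - B v z\<bar>)
        = (\<Sum>u\<in>UNIV. \<Sum>z\<in>UNIV. \<Sum>v\<in>UNIV. p u * q v * \<bar>B u z - B v z\<bar>)"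
      by (rule sum.swap)
    also have "\<dots> = (\<Sum>u\<in>UNIV. \<Sum>v\<in>UNIV. \<Sum>z\<in>UNIV. p u * q v * \<bar>B u z - B v z\<bar>)"
      by (intro sum.cong refl sum.swap)
    finally show ?thesis by (simp add: sum_distrib_left)
  qed
  also have "\<dots> \<le> (\<Sum>u\<in>UNIV. \<Sum>v\<in>UNIV. p u * q v * (2 * dobrushin B))"
    using d(3,4) dobrushin_upper[of B] by (intro sum_mono mult_left_mono) (auto simp: field_simps)
  also have "\<dots> = (\<Sum>u\<in>UNIV. p u) * (\<Sum>v\<in>UNIV. q v) * (2 * dobrushin B)"
    by (simp add: sum_product) (simp add: sum_distrib_right)
  also have "\<dots> = t * (dobrushin B * (\<Sum>u\<in>UNIV. \<bar>d u\<bar>))"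
    by (simp only: q t2 flip: t_def) (simp add: algebra_simps)
  finally show ?thesis using t by simp
qed

lemma dobrushin_mult:
  assumes "markov_kernel A"
  shows "dobrushin (kernel_mult A B) \<le> dobrushin A * dobrushin B"
proof (rule dobrushin_least)
  fix x x'
  have "(\<Sum>z\<in>UNIV. \<bar>kernel_mult A B x z - kernel_mult A B x' z\<bar>)
      = (\<Sum>z\<in>UNIV. \<bar>\<Sum>u\<in>UNIV. (A x u - A x' u) * B u z\<bar>)"
    by (simp add: kernel_mult_def left_diff_distrib sum_subtractf)
  also have "\<dots> \<le> dobrushin B * (\<Sum>u\<in>UNIV. \<bar>A x u - A x' u\<bar>)"
    using markov_kernelD(2)[OF assms] by (intro sum_abs_kernel_le_dobrushin) (simp add: sum_subtractf)
  also have "\<dots> \<le> dobrushin B * (2 * dobrushin A)"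
    using dobrushin_upper[of A x x'] dobrushin_nonneg[of B] by (intro mult_left_mono) auto
  finally show "1 / 2 * (\<Sum>z\<in>UNIV. \<bar>kernel_mult A B x z - kernel_mult A B x' z\<bar>)
      \<le> dobrushin A * dobrushin B"
    by (simp add: algebra_simps)
qed

section \<open>Weak ergodicity\<close>

definition rows_merge :: "(int \<Rightarrow> 'e::finite \<Rightarrow> 'e \<Rightarrow> real) \<Rightarrow> bool" where
  "rows_merge K \<longleftrightarrow> (\<forall>k\<le>0. \<forall>x x' z.
     ((\<lambda>n. backward_prod K n k x z - backward_prod K n k x' z) \<longlongrightarrow> 0) at_bot)"

lemma rows_merge_iff_dobrushin:
  "rows_merge K \<longleftrightarrow> (\<forall>k\<le>0. ((\<lambda>n. dobrushin (backward_prod K n k)) \<longlongrightarrow> 0) at_bot)"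
proof (intro iffI allI impI)
  fix k :: int assume K: "rows_merge K" and k: "k \<le> 0"
  let ?S = "\<lambda>n. \<Sum>(x, x')\<in>UNIV. 1 / 2 * (\<Sum>z\<in>UNIV. \<bar>backward_prod K n k x z - backward_prod K n k x' z\<bar>)"
  have "(?S \<longlongrightarrow> (\<Sum>(x::'a, x'::'a)\<in>UNIV. 1 / 2 * (\<Sum>z\<in>(UNIV::'a set). 0))) at_bot"
    using K k unfolding rows_merge_def case_prod_beta
    by (intro tendsto_sum tendsto_mult tendsto_const tendsto_rabs_zero) auto
  then have S: "(?S \<longlongrightarrow> 0) at_bot"
    by (simp add: case_prod_beta)
  show "((\<lambda>n. dobrushin (backward_prod K n k)) \<longlongrightarrow> 0) at_bot"
  proof (rule tendsto_sandwich[OF _ _ tendsto_const S])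
    have "dobrushin (backward_prod K n k) \<le> ?S n" for n
    proof (rule dobrushin_least)
      fix x x'
      let ?f = "\<lambda>(x, x'). 1 / 2 * (\<Sum>z\<in>UNIV. \<bar>backward_prod K n k x z - backward_prod K n k x' z\<bar>)"
      show "1 / 2 * (\<Sum>z\<in>UNIV. \<bar>backward_prod K n k x z - backward_prod K n k x' z\<bar>) \<le> ?S n"
        using member_le_sum[of "(x, x')" UNIV ?f] by (auto intro: sum_nonneg)
    qed
    then show "\<forall>\<^sub>F n in at_bot. dobrushin (backward_prod K n k) \<le> ?S n" by simp
  qed (simp add: dobrushin_nonneg)
next
  assume D: "\<forall>k\<le>0. ((\<lambda>n. dobrushin (backward_prod K n k)) \<longlongrightarrow> 0) at_bot"
  show "rows_merge K"
    unfolding rows_merge_def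
  proof (intro allI impI)
    fix k :: int and x x' z assume "k \<le> 0"
    then have "((\<lambda>n. 2 * dobrushin (backward_prod K n k)) \<longlongrightarrow> 2 * 0) at_bot"
      using D by (intro tendsto_intros) auto
    then have "((\<lambda>n. 2 * dobrushin (backward_prod K n k)) \<longlongrightarrow> 0) at_bot" by simp
    then show "((\<lambda>n. backward_prod K n k x z - backward_prod K n k x' z) \<longlongrightarrow> 0) at_bot"
      by (rule Lim_null_comparison[rotated]) (simp add: abs_diff_le_dobrushin)
  qed
qed

text \<open>
  Lengthening a product on either side multiplies its coefficient by factors at most one.
\<close>

lemma dobrushin_antimono:
  assumes K: "\<forall>n\<le>0. markov_kernel (K n)" and "n \<le> m" "m \<le> k" "k \<le> l" "l \<le> 0"
  shows "dobrushin (backward_prod K n l) \<le> dobrushin (backward_prod K m k)"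
proof -
  have mk: "markov_kernel (backward_prod K n m)" "markov_kernel (backward_prod K m k)"
    "markov_kernel (backward_prod K k l)"
    using assms by (auto intro: markov_backward_prod)
  have "backward_prod K n l
      = kernel_mult (backward_prod K n m) (kernel_mult (backward_prod K m k) (backward_prod K k l))"
    using backward_prod_comp[of n m l K] backward_prod_comp[of m k l K] assms by simp
  then have "dobrushin (backward_prod K n l)
      \<le> dobrushin (backward_prod K n m) * (dobrushin (backward_prod K m k) * dobrushin (backward_prod K k l))"
    by (auto intro!: order_trans[OF dobrushin_mult[OF mk(1)]] mult_left_mono dobrushin_mult[OF mk(2)]
        dobrushin_nonneg)
  also have "\<dots> \<le> 1 * (dobrushin (backward_prod K m k) * 1)"
    using dobrushin_le_1[OF mk(1)] dobrushin_le_1[OF mk(3)]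
    by (intro mult_mono) (auto simp: dobrushin_nonneg)
  finally show ?thesis by simp
qed

lemma prod_le_exp_sum:
  fixes c :: "'i \<Rightarrow> real"
  assumes "\<And>i. i \<in> I \<Longrightarrow> 0 \<le> c i"
  shows "prod c I \<le> exp (- (\<Sum>i\<in>I. 1 - c i))"
proof (cases "finite I")
  case True
  have "prod c I \<le> (\<Prod>i\<in>I. exp (- (1 - c i)))"
    using assms exp_ge_add_one_self[of "- (1 - c i)" for i] by (intro prod_mono) simp
  then show ?thesis using True by (simp add: exp_sum flip: sum_negf)
qed simp

definition divergent_blocks :: "(int \<Rightarrow> 'e::finite \<Rightarrow> 'e \<Rightarrow> real) \<Rightarrow> bool" where
  "divergent_blocks K \<longleftrightarrow> (\<exists>m :: nat \<Rightarrow> int. (\<forall>i. m i \<le> 0) \<and> (\<forall>i. m (Suc i) < m i) \<and>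
     filterlim (\<lambda>N. \<Sum>i<N. 1 - dobrushin (backward_prod K (m (Suc i)) (m i))) at_top sequentially)"

text \<open>
  The blocks are chosen one after the other into the past, each long enough to have coefficient
  at most \<open>1/2\<close>.
\<close>

lemma rows_merge_imp_divergent_blocks:
  assumes "rows_merge K"
  shows "divergent_blocks K"
proof -
  have "\<exists>m::nat \<Rightarrow> int. \<forall>i. m i \<le> 0 \<and>
      (m (Suc i) < m i \<and> dobrushin (backward_prod K (m (Suc i)) (m i)) \<le> 1 / 2)"
  proof (rule dependent_nat_choice)
    fix k :: int and i :: nat assume k: "k \<le> 0"
    have "\<forall>\<^sub>F n in at_bot. dobrushin (backward_prod K n k) < 1 / 2"
      using assms[unfolded rows_merge_iff_dobrushin, rule_format, OF k] by (rule order_tendstoD) simp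
    then obtain N where "\<And>n. n \<le> N \<Longrightarrow> dobrushin (backward_prod K n k) < 1 / 2"
      by (auto simp: eventually_at_bot_linorder)
    then show "\<exists>n\<le>0. n < k \<and> dobrushin (backward_prod K n k) \<le> 1 / 2"
      using k by (intro exI[of _ "min N (k - 1)"]) (auto intro: less_imp_le)
  qed auto
  then obtain m :: "nat \<Rightarrow> int" where m: "\<And>i. m i \<le> 0" "\<And>i. m (Suc i) < m i"
    "\<And>i. dobrushin (backward_prod K (m (Suc i)) (m i)) \<le> 1 / 2"
    by auto
  have "filterlim (\<lambda>N. \<Sum>i<N. 1 - dobrushin (backward_prod K (m (Suc i)) (m i))) at_top sequentially"
  proof (rule filterlim_at_top_mono)
    show "filterlim (\<lambda>N. real N * (1 / 2)) at_top sequentially"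
      by (intro filterlim_at_top_mult_tendsto_pos[OF tendsto_const _ filterlim_real_sequentially]) simp
    have "real N * (1 / 2) \<le> (\<Sum>i<N. 1 - dobrushin (backward_prod K (m (Suc i)) (m i)))" for N
      using sum_bounded_below[of "{..<N}" "1 / 2" "\<lambda>i. 1 - dobrushin (backward_prod K (m (Suc i)) (m i))"]
        m(3) by (simp add: field_simps)
    then show "\<forall>\<^sub>F N in sequentially. real N * (1 / 2)
        \<le> (\<Sum>i<N. 1 - dobrushin (backward_prod K (m (Suc i)) (m i)))" by simp
  qed
  with m show ?thesis unfolding divergent_blocks_def by blast
qed

text \<open>
  With coefficients \<open>c\<^sub>i\<close> of the blocks, a product over consecutive blocks has coefficient at most
  \<open>\<Prod>c\<^sub>i \<le> exp (- \<Sum>(1 - c\<^sub>i))\<close>.  Monotonicity takes care of times that are not endpoints of blocks.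
\<close>

lemma divergent_blocks_imp_rows_merge:
  assumes K: "\<forall>n\<le>0. markov_kernel (K n)" and "divergent_blocks K"
  shows "rows_merge K"
  unfolding rows_merge_iff_dobrushin
proof (intro allI impI)
  fix k :: int assume k: "k \<le> 0"
  obtain m :: "nat \<Rightarrow> int" where m: "\<And>i. m i \<le> 0" "\<And>i. m (Suc i) < m i"
    and lim: "filterlim (\<lambda>N. \<Sum>i<N. 1 - dobrushin (backward_prod K (m (Suc i)) (m i))) at_top sequentially"
    using assms(2) unfolding divergent_blocks_def by blast
  define c where "c i = dobrushin (backward_prod K (m (Suc i)) (m i))" for i
  have c: "0 \<le> c i" for i by (simp add: c_def dobrushin_nonneg)
  have m_le: "m i \<le> - int i" for i
    using m(1)[of 0] m(2) by (induction i) (auto simp: dual_order.strict_iff_order intro: order_trans, smt (verit) m(2))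
  \<comment> \<open>blocks from the \<open>j\<close>-th on do not extend beyond \<open>k\<close>, as \<open>m j \<le> - j\<close>\<close>
  define j where "j = nat (- k)"
  have mj: "m j \<le> k" using m_le[of j] k by (simp add: j_def)
  have m_anti: "m (j + N) \<le> m j" for N
    using m(2) by (induction N) (auto intro: less_imp_le order_trans)
  have blocks: "dobrushin (backward_prod K (m (j + N)) (m j)) \<le> prod c {j..<j + N}" for N
  proof (induction N)
    case 0
    have "dobrushin (backward_prod K (m j) (m j)) \<le> 1"
      using m(1) by (simp add: backward_prod_refl dobrushin_le_1 markov_kernel_id)
    then show ?case by simp
  next
    case (Suc N)
    have "backward_prod K (m (j + Suc N)) (m j)
        = kernel_mult (backward_prod K (m (j + Suc N)) (m (j + N))) (backward_prod K (m (j + N)) (m j))"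
      using m(2)[of "j + N"] m_anti[of N] by (intro backward_prod_comp) auto
    moreover have "markov_kernel (backward_prod K (m (j + Suc N)) (m (j + N)))"
      using m(1,2)[of "j + N"] K by (intro markov_backward_prod) auto
    ultimately have "dobrushin (backward_prod K (m (j + Suc N)) (m j))
        \<le> c (j + N) * dobrushin (backward_prod K (m (j + N)) (m j))"
      using dobrushin_mult by (metis add_Suc_right c_def)
    also have "\<dots> \<le> c (j + N) * prod c {j..<j + N}"
      using Suc c by (intro mult_left_mono) auto
    finally show ?case by (simp add: mult.commute)
  qed
  show "((\<lambda>n. dobrushin (backward_prod K n k)) \<longlongrightarrow> 0) at_bot"
  proof (rule tendstoI)
    fix e :: real assume e: "0 < e"
    have "\<forall>\<^sub>F N in sequentially. (\<Sum>i<N. 1 - c i) > (\<Sum>i<j. 1 - c i) - ln e"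
      using lim unfolding c_def filterlim_at_top_dense by blast
    then obtain N0 where N0: "\<And>N. N \<ge> N0 \<Longrightarrow> (\<Sum>i<N. 1 - c i) > (\<Sum>i<j. 1 - c i) - ln e"
      by (auto simp: eventually_sequentially)
    have "(\<Sum>i<j + N0. 1 - c i) = (\<Sum>i<j. 1 - c i) + (\<Sum>i=j..<j + N0. 1 - c i)"
      by (simp add: lessThan_atLeast0 sum.atLeastLessThan_concat)
    then have "- (\<Sum>i=j..<j + N0. 1 - c i) < ln e"
      using N0[of "j + N0"] by simp
    then have "exp (- (\<Sum>i=j..<j + N0. 1 - c i)) < e"
      using e by (metis exp_less_mono exp_ln)
    then have small: "dobrushin (backward_prod K (m (j + N0)) (m j)) < e"
      using blocks[of N0] prod_le_exp_sum[of "{j..<j + N0}" c] c by fastforce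
    have "dist (dobrushin (backward_prod K n k)) 0 < e" if "n \<le> m (j + N0)" for n
      using dobrushin_antimono[OF K that m_anti mj k] small dobrushin_nonneg[of "backward_prod K n k"]
      by (simp add: dist_real_def)
    then show "\<forall>\<^sub>F n in at_bot. dist (dobrushin (backward_prod K n k)) 0 < e"
      by (auto simp: eventually_at_bot_linorder)
  qed
qed

section \<open>Sequences of absolute probabilities\<close>

lemma absolute_probsD:
  assumes "\<pi> \<in> absolute_probs K" "n \<le> 0"
  shows "0 \<le> \<pi> n x" "(\<Sum>x\<in>UNIV. \<pi> n x) = 1" "(\<Sum>z\<in>UNIV. \<pi> (n - 1) z * K n z x) = \<pi> n x"
  using assms by (auto simp: absolute_probs_def prob_vector_def)

lemma absolute_probs_backward_prod:
  assumes "\<pi> \<in> absolute_probs K" "n \<le> k" "k \<le> 0"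
  shows "\<pi> k z = (\<Sum>u\<in>UNIV. \<pi> n u * backward_prod K n k u z)"
  using assms(2)
proof (induction n rule: int_le_induct)
  case base
  then show ?case by (simp add: backward_prod_refl kernel_id_def if_distrib[of "\<lambda>c. _ * c"] cong: if_cong)
next
  case (step i)
  then have "\<pi> k z = (\<Sum>v\<in>UNIV. (\<Sum>u\<in>UNIV. \<pi> (i - 1) u * K i u v) * backward_prod K i k v z)"
    using absolute_probsD(3)[OF assms(1), of i] assms(3) by simp
  also have "\<dots> = (\<Sum>u\<in>UNIV. \<pi> (i - 1) u * kernel_mult (K i) (backward_prod K i k) u z)"
    unfolding kernel_mult_def by (simp add: sum_distrib_left sum_distrib_right mult.assoc) (rule sum.swap)
  finally show ?case using step by (simp add: backward_prod_step)
qed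

text \<open>
  \<open>\<pi> k\<close> is the average of the rows of the product over \<open>(n, k]\<close> with weights \<open>\<pi> n\<close>, so no row is
  further from it than the rows are from each other.
\<close>

lemma absolute_probs_limit:
  assumes \<pi>: "\<pi> \<in> absolute_probs K" and K: "rows_merge K" and k: "k \<le> 0"
  shows "((\<lambda>n. backward_prod K n k x z) \<longlongrightarrow> \<pi> k z) at_bot"
proof -
  have "norm (backward_prod K n k x z - \<pi> k z) \<le> 2 * dobrushin (backward_prod K n k)" if n: "n \<le> k" for n
  proof -
    let ?b = "backward_prod K n k"
    have "?b x z - \<pi> k z = (\<Sum>u\<in>UNIV. \<pi> n u * (?b x z - ?b u z))"
      using absolute_probsD(2)[OF \<pi>, of n] n k absolute_probs_backward_prod[OF \<pi> n k, of z]
      by (simp add: right_diff_distrib sum_subtractf flip: sum_distrib_right)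
    also have "norm \<dots> \<le> (\<Sum>u\<in>UNIV. \<pi> n u * (2 * dobrushin ?b))"
      using absolute_probsD(1)[OF \<pi>, of n] n k abs_diff_le_dobrushin[of ?b]
      by (intro sum_norm_le) (auto simp: abs_mult intro!: mult_left_mono)
    also have "\<dots> = 2 * dobrushin ?b"
      using absolute_probsD(2)[OF \<pi>, of n] n k by (simp flip: sum_distrib_right)
    finally show ?thesis .
  qed
  then have *: "\<forall>\<^sub>F n in at_bot. norm (backward_prod K n k x z - \<pi> k z)
      \<le> 2 * dobrushin (backward_prod K n k)"
    by (auto simp: eventually_at_bot_linorder)
  have "((\<lambda>n. 2 * dobrushin (backward_prod K n k)) \<longlongrightarrow> 2 * 0) at_bot"
    using K k unfolding rows_merge_iff_dobrushin by (intro tendsto_intros) auto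
  then have "((\<lambda>n. backward_prod K n k x z - \<pi> k z) \<longlongrightarrow> 0) at_bot"
    using * by (intro Lim_null_comparison[OF *]) simp
  then show ?thesis by (simp add: LIM_zero_iff)
qed

text \<open>
  A diagonal argument over the countably many pairs \<open>(k, z)\<close> makes the rows started at \<open>x\<close> converge at
  all times simultaneously.  The limits are absolute probabilities because the product over \<open>(n, k]\<close> is
  the product over \<open>(n, k - 1]\<close> followed by the \<open>k\<close>-th kernel.
\<close>

lemma absolute_probs_subsequence:
  fixes K :: "int \<Rightarrow> 'e::finite \<Rightarrow> 'e \<Rightarrow> real"
  assumes K: "\<forall>n\<le>0. markov_kernel (K n)" and ns: "filterlim ns at_bot sequentially"
  obtains r \<pi> where "strict_mono (r :: nat \<Rightarrow> nat)" "\<pi> \<in> absolute_probs K"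
    "\<And>k z. k \<le> 0 \<Longrightarrow> (\<lambda>i. backward_prod K (ns (r i)) k x z) \<longlonglongrightarrow> \<pi> k z"
proof -
  \<comment> \<open>the value zero outside the range \<open>ns i \<le> k \<le> 0\<close> keeps \<open>f\<close> bounded\<close>
  define f where "f i = (\<lambda>(k, z). if ns i \<le> k \<and> k \<le> 0 then backward_prod K (ns i) k x z else 0)" for i
  have "norm (f i p) \<le> 1" for i p
    using markov_kernelD(1,3)[OF markov_backward_prod[OF K]] unfolding f_def by (auto split: prod.splits)
  then obtain r :: "nat \<Rightarrow> nat" where r: "strict_mono r"
    and conv: "\<And>p. \<exists>l. (\<lambda>i. f (r i) p) \<longlonglongrightarrow> l"
    using function_convergent_subsequence[of "UNIV :: (int \<times> 'e) set" f 1] by (metis UNIV_I countableI_type)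
  define \<pi> where "\<pi> = (\<lambda>k\<in>{..0}. \<lambda>z. lim (\<lambda>i. f (r i) (k, z)))"
  have nsr: "filterlim (\<lambda>i. ns (r i)) at_bot sequentially"
    using filterlim_compose[OF ns filterlim_subseq[OF r]] .
  then have early: "\<forall>\<^sub>F i in sequentially. ns (r i) \<le> k" for k
    by (simp add: filterlim_at_bot)
  have lim: "(\<lambda>i. backward_prod K (ns (r i)) k x z) \<longlonglongrightarrow> \<pi> k z" if "k \<le> 0" for k z
  proof -
    have "(\<lambda>i. f (r i) (k, z)) \<longlonglongrightarrow> \<pi> k z"
      using conv[of "(k, z)"] that by (auto simp: \<pi>_def convergent_def convergent_LIMSEQ_iff[symmetric])
    moreover have "\<forall>\<^sub>F i in sequentially. f (r i) (k, z) = backward_prod K (ns (r i)) k x z"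
      using early[of k] by eventually_elim (use that in \<open>simp add: f_def\<close>)
    ultimately show ?thesis by (rule Lim_transform_eventually)
  qed
  have mk: "\<forall>\<^sub>F i in sequentially. markov_kernel (backward_prod K (ns (r i)) k)" if "k \<le> 0" for k
    using early[of k] by eventually_elim (use that K in \<open>auto intro: markov_backward_prod\<close>)
  have "\<pi> \<in> absolute_probs K"
    unfolding absolute_probs_def prob_vector_def
  proof (intro CollectI conjI allI impI)
    show "\<pi> \<in> extensional {..0}" by (simp add: \<pi>_def)
    fix k :: int and z assume k: "k \<le> 0"
    show "0 \<le> \<pi> k z"
      by (rule tendsto_lowerbound[OF lim[OF k]])
        (use mk[OF k] in \<open>auto elim!: eventually_mono simp: markov_kernelD\<close>)
    have "(\<lambda>i. \<Sum>z\<in>UNIV. backward_prod K (ns (r i)) k x z) \<longlonglongrightarrow> (\<Sum>z\<in>UNIV. \<pi> k z)"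
      by (intro tendsto_sum lim k)
    moreover have "\<forall>\<^sub>F i in sequentially. (\<Sum>z\<in>UNIV. backward_prod K (ns (r i)) k x z) = 1"
      using mk[OF k] by eventually_elim (simp add: markov_kernelD)
    ultimately show "(\<Sum>z\<in>UNIV. \<pi> k z) = 1"
      by (rule LIMSEQ_unique[OF _ tendsto_eventually])
  next
    fix k :: int and z assume k: "k \<le> 0"
    have "(\<lambda>i. \<Sum>u\<in>UNIV. backward_prod K (ns (r i)) (k - 1) x u * K k u z)
        \<longlonglongrightarrow> (\<Sum>u\<in>UNIV. \<pi> (k - 1) u * K k u z)"
      using k by (intro tendsto_sum tendsto_mult lim tendsto_const) auto
    moreover have "\<forall>\<^sub>F i in sequentially. (\<Sum>u\<in>UNIV. backward_prod K (ns (r i)) (k - 1) x u * K k u z)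
        = backward_prod K (ns (r i)) k x z"
      using early[of "k - 1"]
    proof eventually_elim
      case (elim i)
      have "backward_prod K (k - 1) k = K k"
        by (simp add: backward_prod_def kernel_mult_def kernel_id_def fun_eq_iff
            if_distrib[of "\<lambda>c. _ * c"] cong: if_cong)
      then show ?case
        using backward_prod_comp[OF elim, of k K] by (simp add: kernel_mult_def)
    qed
    ultimately have "(\<lambda>i. backward_prod K (ns (r i)) k x z) \<longlonglongrightarrow> (\<Sum>u\<in>UNIV. \<pi> (k - 1) u * K k u z)"
      by (rule Lim_transform_eventually)
    then show "(\<Sum>u\<in>UNIV. \<pi> (k - 1) u * K k u z) = \<pi> k z"
      using lim[OF k] LIMSEQ_unique by blast
  qed
  with r lim show ?thesis using that by blast
qed

lemma filterlim_minus_nat_at_bot: "filterlim (\<lambda>i. - int i) at_bot sequentially"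
  unfolding filterlim_at_bot eventually_sequentially
  by (metis minus_le_iff nat_le_iff)

lemma rows_merge_imp_unique:
  assumes K: "\<forall>n\<le>0. markov_kernel (K n)" and "rows_merge K"
  shows "\<exists>\<pi>. absolute_probs K = {\<pi>}"
proof -
  obtain \<pi> where \<pi>: "\<pi> \<in> absolute_probs K"
    using absolute_probs_subsequence[OF K filterlim_minus_nat_at_bot] by blast
  have "\<pi>' = \<pi>" if \<pi>': "\<pi>' \<in> absolute_probs K" for \<pi>'
  proof (rule extensionalityI)
    show "\<pi>' \<in> extensional {..0}" "\<pi> \<in> extensional {..0}"
      using \<pi> \<pi>' by (auto simp: absolute_probs_def)
    fix k :: int assume "k \<in> {..0}"
    then show "\<pi>' k = \<pi> k"
      using tendsto_unique[OF trivial_limit_at_bot_linorder absolute_probs_limit[OF \<pi>' assms(2)]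
          absolute_probs_limit[OF \<pi> assms(2)], of k]
      by (intro ext) auto
  qed
  with \<pi> show ?thesis by blast
qed

text \<open>
  If the rows of \<open>x\<close> and \<open>x'\<close> stay apart at \<open>z\<close> along a sequence of starting times, passing to the
  limit along a common subsequence yields two absolute probabilities that differ at \<open>(k, z)\<close>.
\<close>

lemma unique_imp_rows_merge:
  assumes K: "\<forall>n\<le>0. markov_kernel (K n)" and unique: "absolute_probs K = {\<pi>}"
  shows "rows_merge K"
  unfolding rows_merge_def
proof (intro allI impI, rule ccontr)
  fix k :: int and x x' z assume k: "k \<le> 0"
  define f where "f n = backward_prod K n k x z - backward_prod K n k x' z" for n
  assume "\<not> ((\<lambda>n. backward_prod K n k x z - backward_prod K n k x' z) \<longlongrightarrow> 0) at_bot"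
  then obtain e where e: "e > 0" "\<And>N. \<exists>n\<le>N. \<bar>f n\<bar> \<ge> e"
    unfolding f_def[symmetric] tendsto_iff by (auto simp: eventually_at_bot_linorder not_less)
  from e(2)[of "- int i" for i] obtain ns :: "nat \<Rightarrow> int"
    where ns: "\<And>i. ns i \<le> - int i" "\<And>i. \<bar>f (ns i)\<bar> \<ge> e"
    by metis
  have ns_lim: "filterlim ns at_bot sequentially"
    by (rule filterlim_at_bot_mono[OF filterlim_minus_nat_at_bot]) (simp add: ns)
  obtain r \<pi>1 where r: "strict_mono (r :: nat \<Rightarrow> nat)" and "\<pi>1 \<in> absolute_probs K"
    and lim1: "\<And>k z. k \<le> 0 \<Longrightarrow> (\<lambda>i. backward_prod K (ns (r i)) k x z) \<longlonglongrightarrow> \<pi>1 k z"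
    using absolute_probs_subsequence[OF K ns_lim] by metis
  have nsr_lim: "filterlim (\<lambda>i. ns (r i)) at_bot sequentially"
    using filterlim_compose[OF ns_lim filterlim_subseq[OF r]] .
  then obtain r' \<pi>2 where r': "strict_mono (r' :: nat \<Rightarrow> nat)" and "\<pi>2 \<in> absolute_probs K"
    and lim2: "\<And>k z. k \<le> 0 \<Longrightarrow> (\<lambda>i. backward_prod K (ns (r (r' i))) k x' z) \<longlonglongrightarrow> \<pi>2 k z"
    using absolute_probs_subsequence[OF K nsr_lim] by metis
  have "\<pi>1 = \<pi>" "\<pi>2 = \<pi>"
    using unique \<open>\<pi>1 \<in> _\<close> \<open>\<pi>2 \<in> _\<close> by auto
  then have "(\<lambda>i. f (ns (r (r' i)))) \<longlonglongrightarrow> \<pi> k z - \<pi> k z"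
    unfolding f_def
    using LIMSEQ_subseq_LIMSEQ[OF lim1[OF k] r'] lim2[OF k] by (intro tendsto_diff) (auto simp: o_def)
  then have "(\<lambda>i. \<bar>f (ns (r (r' i)))\<bar>) \<longlonglongrightarrow> 0"
    by (simp add: tendsto_rabs_zero)
  then have "e \<le> 0"
    by (rule tendsto_lowerbound) (use ns in auto)
  with e show False by simp
qed

section \<open>The flow of independent random maps\<close>

lemma flow_comp:
  assumes "l \<le> n" "n \<le> k"
  shows "flow \<xi> l k = flow \<xi> n k \<circ> flow \<xi> l n"
proof -
  have "[l + 1..k] = [l + 1..n] @ [n + 1..k]"
    using upto_split1[of "l + 1" "n + 1" k] upto_split2[of "l + 1" n k] assms
    by (cases "l = n") auto
  then show ?thesis by (simp add: flow_def)
qed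

lemma flow_single: "flow \<xi> (n - 1) n = \<xi> n"
  by (simp add: flow_def)

lemma flow_cong: "(\<And>n. l < n \<Longrightarrow> n \<le> k \<Longrightarrow> \<xi> n = \<zeta> n) \<Longrightarrow> flow \<xi> l k = flow \<zeta> l k"
  unfolding flow_def by (intro ext fold_cong) auto

definition constant_map :: "('a \<Rightarrow> 'b) \<Rightarrow> bool" where
  "constant_map f \<longleftrightarrow> (\<forall>x x'. f x = f x')"

lemma is_singleton_range_iff: "is_singleton (range f) \<longleftrightarrow> constant_map f"
proof
  assume "is_singleton (range f)"
  then show "constant_map f"
    unfolding is_singleton_def constant_map_def by (metis rangeI singletonD)
next
  assume "constant_map f"
  then have "range f = {f undefined}" by (auto simp: constant_map_def)
  then show "is_singleton (range f)" by (auto simp: is_singleton_def)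
qed

lemma constant_map_comp: "constant_map f \<or> constant_map g \<Longrightarrow> constant_map (f \<circ> g)"
  by (auto simp: constant_map_def) metis

lemma coal_time_gt_iff: "coal_time k \<xi> > Minf \<longleftrightarrow> (\<exists>n<k. constant_map (flow \<xi> n k))"
  by (auto simp: coal_time_def is_singleton_range_iff Let_def)

lemma Sup_int_in:
  fixes S :: "int set"
  assumes "m \<in> S" "\<And>n. n \<in> S \<Longrightarrow> n \<le> k"
  shows "Sup S \<in> S" "m \<le> Sup S"
proof -
  have fin: "finite {n \<in> S. m \<le> n}" by (rule finite_subset[of _ "{m..k}"]) (use assms in auto)
  have ne: "{n \<in> S. m \<le> n} \<noteq> {}" using assms by auto
  have "Sup S = Max {n \<in> S. m \<le> n}"
  proof (rule cSup_eq_maximum)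
    show "Max {n \<in> S. m \<le> n} \<in> S" using Max_in[OF fin ne] by auto
    fix n assume n: "n \<in> S"
    show "n \<le> Max {n \<in> S. m \<le> n}"
    proof (cases "m \<le> n")
      case False
      moreover have "m \<le> Max {n \<in> S. m \<le> n}" using Max_in[OF fin ne] by auto
      ultimately show ?thesis by simp
    qed (use fin n in auto)
  qed
  then show "Sup S \<in> S" "m \<le> Sup S" using Max_in[OF fin ne] by auto
qed

text \<open>
  A map that is already constant from time \<open>n\<close> on forgets everything before \<open>n\<close>, so stopping at
  the last coalescence time or at any earlier one produces the same value.
\<close>

lemma coal_map_eq_flow:
  assumes "n < k" "constant_map (flow \<xi> n k)"
  shows "coal_map k \<xi> x = flow \<xi> n k x"
proof -
  let ?S = "{n. n < k \<and> is_singleton (range (flow \<xi> n k))}"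
  have n: "n \<in> ?S" using assms by (simp add: is_singleton_range_iff)
  have T: "Sup ?S \<in> ?S" "n \<le> Sup ?S"
    by (rule Sup_int_in[OF n, of k]; simp)+
  have "coal_map k \<xi> x = flow \<xi> (Sup ?S) k x"
    using n by (auto simp: coal_map_def coal_time_def Let_def)
  also have "\<dots> = flow \<xi> (Sup ?S) k (flow \<xi> n (Sup ?S) x)"
    using T(1) by (simp add: is_singleton_range_iff constant_map_def)
  also have "\<dots> = flow \<xi> n k x"
    using flow_comp[of n "Sup ?S" k \<xi>] T by simp
  finally show ?thesis .
qed

text \<open>
  When \<open>f\<close> merges points of \<open>A\<close>, the right-hand side has fewer factors, each of them at most one.
\<close>

lemma prod_le_prod_image:
  fixes h :: "'b \<Rightarrow> real"
  assumes "finite A" "\<And>u. 0 \<le> h u" "\<And>u. h u \<le> 1"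
  shows "(\<Prod>x\<in>A. h (f x)) \<le> (\<Prod>u\<in>f ` A. h u)"
  using assms(1)
proof (induction A rule: finite_induct)
  case (insert x A)
  show ?case
  proof (cases "f x \<in> f ` A")
    case True
    have "(\<Prod>x\<in>insert x A. h (f x)) \<le> 1 * (\<Prod>x\<in>A. h (f x))"
      using insert.hyps assms by (simp add: mult_left_le_one_le prod_nonneg)
    also have "\<dots> \<le> (\<Prod>u\<in>f ` insert x A. h u)"
      using insert.IH True by (simp add: insert_absorb)
    finally show ?thesis .
  next
    case False
    then show ?thesis
      using insert assms by (simp add: mult_left_mono)
  qed
qed simp

text \<open>
  The one-point laws \<open>law\<close> together with the independence of all coordinates determine the joint law
  of the random maps \<open>\<xi> n\<close>.
\<close>

locale random_flow = prob_space R
  for R :: "(int \<Rightarrow> 'e::finite \<Rightarrow> 'e) measure" and K :: "int \<Rightarrow> 'e \<Rightarrow> 'e \<Rightarrow> real" +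
  assumes markov: "\<forall>n\<le>0. markov_kernel (K n)"
    and indep: "indep_vars (\<lambda>_. count_space UNIV) (\<lambda>(n, x) \<xi>. \<xi> n x) ({..0} \<times> UNIV)"
    and law: "n \<le> 0 \<Longrightarrow> \<P>(\<xi> in R. \<xi> n x = x') = K n x x'"
begin

lemma flow_measurable_restrict:
  "(\<lambda>w. flow (\<lambda>n x. w (n, x)) l k) \<in>
     PiM ({l + 1..k} \<times> UNIV) (\<lambda>_. count_space UNIV) \<rightarrow>\<^sub>M count_space (UNIV :: ('e \<Rightarrow> 'e) set)"
  by (subst count_space_PiM_finite) (auto intro: countable_finite)

text \<open>
  The two flows read the coordinates of disjoint sets of times.
\<close>

lemma flow_indep:
  assumes "l \<le> n" "n \<le> k" "k \<le> 0"
  shows "indep_var (count_space UNIV) (\<lambda>\<xi>. flow \<xi> l n) (count_space UNIV) (\<lambda>\<xi>. flow \<xi> n k)"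
proof -
  have "indep_var (count_space UNIV)
      ((\<lambda>w. flow (\<lambda>n x. w (n, x)) l n) \<circ> (\<lambda>\<xi>. \<lambda>p\<in>{l + 1..n} \<times> UNIV. (case p of (n, x) \<Rightarrow> \<lambda>\<xi>. \<xi> n x) \<xi>))
      (count_space UNIV)
      ((\<lambda>w. flow (\<lambda>n x. w (n, x)) n k) \<circ> (\<lambda>\<xi>. \<lambda>p\<in>{n + 1..k} \<times> UNIV. (case p of (n, x) \<Rightarrow> \<lambda>\<xi>. \<xi> n x) \<xi>))"
    using assms
    by (intro indep_var_compose[OF indep_var_restrict[OF indep]] flow_measurable_restrict) auto
  moreover have "((\<lambda>w. flow (\<lambda>n x. w (n, x)) l k) \<circ> (\<lambda>\<xi>. \<lambda>p\<in>{l + 1..k} \<times> UNIV. (case p of (n, x) \<Rightarrow> \<lambda>\<xi>. \<xi> n x) \<xi>))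
      = (\<lambda>\<xi> :: int \<Rightarrow> 'e \<Rightarrow> 'e. flow \<xi> l k)" for l k
    by (intro ext) (auto intro!: fun_cong[OF flow_cong])
  ultimately show ?thesis by (simp only:)
qed

lemma flow_measurable [measurable]:
  assumes "n \<le> k" "k \<le> 0"
  shows "(\<lambda>\<xi>. flow \<xi> n k) \<in> R \<rightarrow>\<^sub>M count_space UNIV"
  using indep_var_rv1[OF flow_indep[of n k k]] assms by simp

lemma flow_event:
  assumes "n \<le> k" "k \<le> 0"
  shows "{\<xi> \<in> space R. flow \<xi> n k \<in> S} \<in> events"
proof -
  have [measurable]: "(\<lambda>\<xi>. flow \<xi> n k) \<in> R \<rightarrow>\<^sub>M count_space UNIV"
    using assms by (rule flow_measurable)
  show ?thesis by measurable
qed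

lemma law_map:
  assumes "n \<le> 0"
  shows "\<P>(\<xi> in R. \<xi> n = f) = (\<Prod>x\<in>UNIV. K n x (f x))"
proof -
  have "{\<xi> \<in> space R. \<xi> n = f}
      = (\<Inter>p\<in>{n} \<times> UNIV. (case p of (n, x) \<Rightarrow> \<lambda>\<xi>. \<xi> n x) -` {f (snd p)} \<inter> space R)"
    by (auto simp: fun_eq_iff)
  then have "\<P>(\<xi> in R. \<xi> n = f)
      = (\<Prod>p\<in>{n} \<times> UNIV. prob ((case p of (n, x) \<Rightarrow> \<lambda>\<xi>. \<xi> n x) -` {f (snd p)} \<inter> space R))"
    using assms by (simp only:) (rule indep_varsD[OF indep], auto)
  also have "\<dots> = (\<Prod>p\<in>Pair n ` UNIV. \<P>(\<xi> in R. \<xi> n (snd p) = f (snd p)))"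
    by (intro prod.cong arg_cong[where f=prob]) auto
  also have "\<dots> = (\<Prod>x\<in>UNIV. K n x (f x))"
    using assms law by (subst prod.reindex) (auto simp: inj_on_def)
  finally show ?thesis .
qed

text \<open>
  Decomposition according to the first map \<open>\<xi> n\<close>, which is independent of the flow after time \<open>n\<close>.
\<close>

lemma prob_flow_step:
  assumes "n \<le> k" "k \<le> 0"
  shows "\<P>(\<xi> in R. flow \<xi> (n - 1) k \<in> S)
    = (\<Sum>f\<in>UNIV. (\<Prod>x\<in>UNIV. K n x (f x)) * \<P>(\<xi> in R. flow \<xi> n k \<circ> f \<in> S))"
proof -
  let ?E = "\<lambda>f. {\<xi> \<in> space R. flow \<xi> (n - 1) n \<in> {f} \<and> flow \<xi> n k \<in> {h. h \<circ> f \<in> S}}"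
  have ev: "?E f \<in> events" for f
  proof -
    have [measurable]: "(\<lambda>\<xi>. flow \<xi> n k) \<in> R \<rightarrow>\<^sub>M count_space UNIV"
      "(\<lambda>\<xi>. flow \<xi> (n - 1) n) \<in> R \<rightarrow>\<^sub>M count_space UNIV"
      using assms by (auto intro: flow_measurable)
    show ?thesis by measurable
  qed
  have "{\<xi> \<in> space R. flow \<xi> (n - 1) k \<in> S} = (\<Union>f\<in>UNIV. ?E f)"
    using assms by (auto simp: flow_comp[of "n - 1" n k])
  then have "\<P>(\<xi> in R. flow \<xi> (n - 1) k \<in> S) = prob (\<Union>f\<in>UNIV. ?E f)" by simp
  also have "\<dots> = (\<Sum>f\<in>UNIV. prob (?E f))"
    using ev by (intro finite_measure_finite_Union) (auto simp: disjoint_family_on_def)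
  also have "\<dots> = (\<Sum>f\<in>UNIV. \<P>(\<xi> in R. flow \<xi> (n - 1) n \<in> {f}) * \<P>(\<xi> in R. flow \<xi> n k \<in> {h. h \<circ> f \<in> S}))"
    using assms
    by (intro sum.cong refl prob_indep_random_variable[where N = "count_space UNIV"] flow_indep) auto
  finally show ?thesis using assms law_map by (simp add: flow_single)
qed

text \<open>
  The images under \<open>\<xi> n\<close> of different points are independent, so the expectation of the product
  factorises; the points outside \<open>A\<close> contribute factors one.
\<close>

lemma sum_maps_prod:
  assumes n: "n \<le> 0"
  shows "(\<Sum>f\<in>UNIV. (\<Prod>x\<in>UNIV. K n x (f x)) * (\<Prod>x\<in>A. h (f x))) = (\<Prod>x\<in>A. \<Sum>u\<in>UNIV. K n x u * h u)"
proof -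
  let ?w = "\<lambda>x u. K n x u * (if x \<in> A then h u else 1)"
  have "(\<Prod>x\<in>UNIV. ?w x (f x)) = (\<Prod>x\<in>UNIV. K n x (f x)) * (\<Prod>x\<in>A. h (f x))" for f
    by (simp add: prod.distrib prod.If_cases)
  then have "(\<Sum>f\<in>UNIV. (\<Prod>x\<in>UNIV. K n x (f x)) * (\<Prod>x\<in>A. h (f x)))
      = (\<Sum>f\<in>(\<Pi>\<^sub>E x\<in>UNIV. UNIV). \<Prod>x\<in>UNIV. ?w x (f x))"
    by (simp add: PiE_UNIV_domain)
  also have "\<dots> = (\<Prod>x\<in>UNIV. \<Sum>u\<in>UNIV. ?w x u)"
    by (subst prod_sum_PiE) auto
  also have "\<dots> = (\<Prod>x\<in>UNIV. if x \<in> A then \<Sum>u\<in>UNIV. K n x u * h u else 1)"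
    using markov n by (intro prod.cong refl) (auto simp: markov_kernelD(2))
  also have "\<dots> = (\<Prod>x\<in>A. \<Sum>u\<in>UNIV. K n x u * h u)"
    by (simp add: prod.If_cases)
  finally show ?thesis .
qed

lemma prob_flow_point:
  assumes "n \<le> k" "k \<le> 0"
  shows "\<P>(\<xi> in R. flow \<xi> n k x = z) = backward_prod K n k x z"
  using assms(1)
proof (induction n arbitrary: x rule: int_le_induct)
  case base
  then show ?case by (simp add: backward_prod_refl flow_refl kernel_id_def prob_space)
next
  case (step i)
  then show ?case
    using prob_flow_step[of i k "{h. h x = z}"] sum_maps_prod[where n = i and A = "{x}" and h = "\<lambda>u. backward_prod K i k u z"] assms
    by (simp add: backward_prod_step kernel_mult_def)
qed

text \<open>
  Merging only helps: once two trajectories have met they are sent to \<open>z\<close> by a single chain instead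
  of two, so the coalescing trajectories hit \<open>z\<close> together at least as often as independent copies.
\<close>

lemma prob_flow_joint_ge:
  assumes "n \<le> k" "k \<le> 0"
  shows "(\<Prod>x\<in>A. backward_prod K n k x z) \<le> \<P>(\<xi> in R. \<forall>x\<in>A. flow \<xi> n k x = z)"
  using assms(1)
proof (induction n arbitrary: A rule: int_le_induct)
  case base
  show ?case
  proof (cases "A \<subseteq> {z}")
    case True
    then have "{\<xi> \<in> space R. \<forall>x\<in>A. flow \<xi> k k x = z} = space R" by (auto simp: flow_refl)
    then show ?thesis
      using True by (auto simp: backward_prod_refl kernel_id_def prob_space subset_iff intro!: prod_le_1)
  next
    case False
    then have "\<exists>x\<in>A. backward_prod K k k x z = 0"
      by (auto simp: backward_prod_refl kernel_id_def)
    then have "(\<Prod>x\<in>A. backward_prod K k k x z) = 0"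
      by (intro prod_zero) auto
    then show ?thesis by (simp only: measure_nonneg)
  qed
next
  case (step i)
  let ?b = "\<lambda>u. backward_prod K i k u z"
  have b: "0 \<le> ?b u" "?b u \<le> 1" for u
    using markov_kernelD(1,3)[OF markov_backward_prod[OF markov step(1) assms(2)]] by auto
  have i: "i \<le> 0" using step assms by simp
  have "(\<Prod>x\<in>A. backward_prod K (i - 1) k x z) = (\<Sum>f\<in>UNIV. (\<Prod>x\<in>UNIV. K i x (f x)) * (\<Prod>x\<in>A. ?b (f x)))"
    using sum_maps_prod[OF i, where A = A and h = ?b] step(1) by (simp add: backward_prod_step kernel_mult_def)
  also have "\<dots> \<le> (\<Sum>f\<in>UNIV. (\<Prod>x\<in>UNIV. K i x (f x)) * \<P>(\<xi> in R. \<forall>u\<in>f ` A. flow \<xi> i k u = z))"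
  proof (intro sum_mono mult_left_mono)
    fix f
    show "(\<Prod>x\<in>A. ?b (f x)) \<le> \<P>(\<xi> in R. \<forall>u\<in>f ` A. flow \<xi> i k u = z)"
      using prod_le_prod_image[of A ?b f] b step.IH[of "f ` A"] by simp
    show "0 \<le> (\<Prod>x\<in>UNIV. K i x (f x))"
      using markov i by (auto intro!: prod_nonneg simp: markov_kernelD)
  qed
  also have "\<dots> = \<P>(\<xi> in R. \<forall>x\<in>A. flow \<xi> (i - 1) k x = z)"
    using prob_flow_step[of i k "{h. \<forall>x\<in>A. h x = z}"] step(1) assms(2) by simp
  finally show ?case .
qed

definition nonconstant_prob :: "int \<Rightarrow> int \<Rightarrow> real" where
  "nonconstant_prob n k = \<P>(\<xi> in R. \<not> constant_map (flow \<xi> n k))"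

lemma nonconstant_prob_bounds: "0 \<le> nonconstant_prob n k" "nonconstant_prob n k \<le> 1"
  by (auto simp: nonconstant_prob_def)

lemma constant_event:
  assumes "n \<le> k" "k \<le> 0"
  shows "{\<xi> \<in> space R. constant_map (flow \<xi> n k)} \<in> events"
    "{\<xi> \<in> space R. \<not> constant_map (flow \<xi> n k)} \<in> events"
  using flow_event[OF assms, of "Collect constant_map"] flow_event[OF assms, of "- Collect constant_map"]
  by simp_all

text \<open>
  A composition is constant as soon as one of its parts is, and the two parts are independent.
\<close>

lemma nonconstant_prob_submult:
  assumes "l \<le> n" "n \<le> k" "k \<le> 0"
  shows "nonconstant_prob l k \<le> nonconstant_prob l n * nonconstant_prob n k"
proof -
  let ?N = "- Collect constant_map :: ('e \<Rightarrow> 'e) set"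
  have "{\<xi> \<in> space R. \<not> constant_map (flow \<xi> l k)}
      \<subseteq> {\<xi> \<in> space R. flow \<xi> l n \<in> ?N \<and> flow \<xi> n k \<in> ?N}"
    using assms constant_map_comp by (auto simp: flow_comp[of l n k])
  moreover have "{\<xi> \<in> space R. flow \<xi> l n \<in> ?N \<and> flow \<xi> n k \<in> ?N} \<in> events"
    using flow_event[of l n ?N] flow_event[of n k ?N] assms by (simp add: sets.sets_Collect_conj)
  ultimately have "nonconstant_prob l k \<le> \<P>(\<xi> in R. flow \<xi> l n \<in> ?N \<and> flow \<xi> n k \<in> ?N)"
    unfolding nonconstant_prob_def by (rule finite_measure_mono)
  also have "\<dots> = nonconstant_prob l n * nonconstant_prob n k"
    unfolding nonconstant_prob_def using prob_indep_random_variable[OF flow_indep[OF assms], of ?N ?N] by simp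
  finally show ?thesis .
qed

lemma coal_time_event:
  assumes "k \<le> 0"
  shows "{\<xi> \<in> space R. coal_time k \<xi> > Minf} \<in> events"
proof -
  have "{\<xi> \<in> space R. coal_time k \<xi> > Minf}
      = (\<Union>n\<in>{..<k}. {\<xi> \<in> space R. constant_map (flow \<xi> n k)})"
    by (auto simp: coal_time_gt_iff)
  also have "\<dots> \<in> events"
    using assms by (intro sets.countable_UN') (auto simp: constant_event)
  finally show ?thesis .
qed

lemma no_coalescence_le_nonconstant_prob:
  assumes "n < k" "k \<le> 0"
  shows "1 - \<P>(\<xi> in R. coal_time k \<xi> > Minf) \<le> nonconstant_prob n k"
proof -
  have "{\<xi> \<in> space R. constant_map (flow \<xi> n k)} \<subseteq> {\<xi> \<in> space R. coal_time k \<xi> > Minf}"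
    using assms by (auto simp: coal_time_gt_iff)
  then have "\<P>(\<xi> in R. constant_map (flow \<xi> n k)) \<le> \<P>(\<xi> in R. coal_time k \<xi> > Minf)"
    using assms by (intro finite_measure_mono coal_time_event)
  moreover have "nonconstant_prob n k = 1 - \<P>(\<xi> in R. constant_map (flow \<xi> n k))"
    unfolding nonconstant_prob_def using assms by (intro prob_neg) (simp add: constant_event)
  ultimately show ?thesis by simp
qed

text \<open>
  As \<open>n\<close> decreases, the events that the flow over \<open>(n, k]\<close> is not constant decrease to the event
  that there is no coalescence time.
\<close>

lemma nonconstant_prob_tendsto:
  assumes "k \<le> 0"
  shows "((\<lambda>n. nonconstant_prob n k) \<longlongrightarrow> 1 - \<P>(\<xi> in R. coal_time k \<xi> > Minf)) at_bot"
proof (rule decreasing_tendsto)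
  show "\<forall>\<^sub>F n in at_bot. 1 - \<P>(\<xi> in R. coal_time k \<xi> > Minf) \<le> nonconstant_prob n k"
    unfolding eventually_at_bot_linorder
    using assms by (intro exI[of _ "k - 1"]) (auto intro: no_coalescence_le_nonconstant_prob)
  fix a assume a: "1 - \<P>(\<xi> in R. coal_time k \<xi> > Minf) < a"
  let ?A = "\<lambda>i::nat. {\<xi> \<in> space R. \<not> constant_map (flow \<xi> (k - 1 - int i) k)}"
  have mono: "{\<xi> \<in> space R. \<not> constant_map (flow \<xi> l k)} \<subseteq> {\<xi> \<in> space R. \<not> constant_map (flow \<xi> n k)}"
    if "l \<le> n" "n \<le> k" for l n
    using constant_map_comp by (auto simp: flow_comp[OF that])
  have "(\<lambda>i. prob (?A i)) \<longlonglongrightarrow> prob (\<Inter>i. ?A i)"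
    using assms mono by (intro finite_Lim_measure_decseq) (auto simp: constant_event decseq_def)
  also have "(\<Inter>i. ?A i) = {\<xi> \<in> space R. \<not> coal_time k \<xi> > Minf}"
    unfolding coal_time_gt_iff
  proof (intro equalityI subsetI; clarsimp)
    fix \<xi> n assume \<xi>: "\<forall>i. \<not> constant_map (flow \<xi> (k - 1 - int i) k)" and "n < k" "constant_map (flow \<xi> n k)"
    then show False using \<xi>[rule_format, of "nat (k - 1 - n)"] by simp
  qed
  also have "prob \<dots> = 1 - \<P>(\<xi> in R. coal_time k \<xi> > Minf)"
    using assms by (intro prob_neg coal_time_event)
  finally have "\<forall>\<^sub>F i in sequentially. prob (?A i) < a"
    using a by (rule order_tendstoD)
  then obtain i where i: "prob (?A i) < a" by (auto simp: eventually_sequentially)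
  have "nonconstant_prob n k < a" if "n \<le> k - 1 - int i" for n
    unfolding nonconstant_prob_def
    using i that assms by (intro le_less_trans[OF finite_measure_mono[OF mono] i]) (auto simp: constant_event)
  then show "\<forall>\<^sub>F n in at_bot. nonconstant_prob n k < a"
    by (auto simp: eventually_at_bot_linorder)
qed

text \<open>
  When the rows of the product over \<open>(n, k]\<close> are close together, some state \<open>z\<close> has probability
  bounded below from every starting point; the whole space is then sent to \<open>z\<close> with a probability
  bounded away from zero.
\<close>

lemma ex_coalescing_block:
  assumes K: "rows_merge K" and k: "k \<le> 0"
  shows "\<exists>n<k. nonconstant_prob n k \<le> 1 - (1 / (2 * real CARD('e))) ^ CARD('e)"
proof -
  define s where "s = real CARD('e)"
  have s: "s > 0" by (simp add: s_def)
  have "((\<lambda>n. dobrushin (backward_prod K n k)) \<longlongrightarrow> 0) at_bot"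
    using K k unfolding rows_merge_iff_dobrushin by simp
  \<comment> \<open>rows then differ by less than \<open>1 / (2 * s)\<close> in each entry, and each has an entry of at least \<open>1 / s\<close>\<close>
  moreover have "0 < 1 / (4 * s)" using s by simp
  ultimately have "\<forall>\<^sub>F n in at_bot. dobrushin (backward_prod K n k) < 1 / (4 * s)"
    by (rule order_tendstoD)
  then obtain N where N: "\<And>n. n \<le> N \<Longrightarrow> dobrushin (backward_prod K n k) < 1 / (4 * s)"
    by (auto simp: eventually_at_bot_linorder)
  define n where "n = min N (k - 1)"
  let ?b = "backward_prod K n k"
  have n: "n < k" "dobrushin ?b < 1 / (4 * s)" using N by (auto simp: n_def)
  have mk: "markov_kernel ?b" using n k by (intro markov_backward_prod markov) auto
  have "\<exists>z. 1 / s \<le> ?b undefined z"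
  proof (rule ccontr)
    assume "\<nexists>z. 1 / s \<le> ?b undefined z"
    then have "(\<Sum>z\<in>UNIV. ?b undefined z) < (\<Sum>z\<in>(UNIV::'e set). 1 / s)"
      by (intro sum_strict_mono) (auto simp: not_le)
    then show False using markov_kernelD(2)[OF mk] by (simp add: s_def)
  qed
  then obtain z where z: "1 / s \<le> ?b undefined z" ..
  have "1 / (2 * s) \<le> ?b x z" for x
  proof -
    have "2 * dobrushin ?b < 1 / (2 * s)" using n(2) by simp
    moreover have "1 / s = 1 / (2 * s) + 1 / (2 * s)" using s by (simp add: field_simps)
    ultimately show ?thesis
      using abs_diff_le_dobrushin[of ?b undefined z x] z by linarith
  qed
  then have "(1 / (2 * s)) ^ CARD('e) \<le> (\<Prod>x\<in>UNIV. ?b x z)"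
    using prod_mono[of UNIV "\<lambda>_::'e. 1 / (2 * s)" "\<lambda>x. ?b x z"] s by simp
  also have "\<dots> \<le> \<P>(\<xi> in R. \<forall>x\<in>UNIV. flow \<xi> n k x = z)"
    using n k by (intro prob_flow_joint_ge) auto
  also have "\<dots> \<le> \<P>(\<xi> in R. constant_map (flow \<xi> n k))"
    using n k by (intro finite_measure_mono constant_event) (auto simp: constant_map_def)
  also have "\<dots> = 1 - nonconstant_prob n k"
    unfolding nonconstant_prob_def using n k prob_neg[OF constant_event(1)[of n k]] by simp
  finally show ?thesis using n by (auto simp: s_def)
qed

text \<open>
  Independent blocks, each of which coalesces with probability at least \<open>c\<close>, are placed one before
  the other; \<open>j\<close> of them fail to coalesce with probability at most \<open>(1 - c)^j\<close>.
\<close>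

lemma rows_merge_imp_coalescence:
  assumes K: "rows_merge K"
  shows "coalescence R"
  unfolding coalescence_def
proof (intro allI impI)
  fix k :: int assume k: "k \<le> 0"
  define c where "c = (1 / (2 * real CARD('e))) ^ CARD('e)"
  have "1 \<le> real CARD('e)" by (simp add: Suc_leI)
  then have "1 \<le> 2 * real CARD('e)" by linarith
  then have c: "0 < c" "c \<le> 1"
    unfolding c_def by (simp, intro power_le_one) (simp_all add: divide_simps)
  \<comment> \<open>the bound \<open>n < k - j + 1\<close> ensures \<open>n < k\<close> for \<open>j \<ge> 1\<close>, as coalescence times are strictly before \<open>k\<close>\<close>
  have blocks: "\<exists>n\<le>k. n < k - int j + 1 \<and> nonconstant_prob n k \<le> (1 - c) ^ j" for j
  proof (induction j)
    case 0
    show ?case using nonconstant_prob_bounds by (intro exI[of _ k]) auto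
  next
    case (Suc j)
    then obtain n where n: "n \<le> k" "n < k - int j + 1" "nonconstant_prob n k \<le> (1 - c) ^ j" by blast
    obtain l where l: "l < n" "nonconstant_prob l n \<le> 1 - c"
      using ex_coalescing_block[OF K, of n] n k by (auto simp: c_def)
    have "nonconstant_prob l k \<le> nonconstant_prob l n * nonconstant_prob n k"
      using l n k by (intro nonconstant_prob_submult) auto
    also have "\<dots> \<le> (1 - c) * (1 - c) ^ j"
      using l n c nonconstant_prob_bounds by (intro mult_mono) auto
    finally show ?case using l n by (intro exI[of _ l]) auto
  qed
  let ?p = "1 - \<P>(\<xi> in R. coal_time k \<xi> > Minf)"
  have "?p \<le> (1 - c) ^ j" if "j \<ge> 1" for j
    using blocks[of j] that no_coalescence_le_nonconstant_prob[OF _ k] by (smt (verit) of_nat_1 of_nat_mono)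
  moreover have "(\<lambda>j. (1 - c) ^ j) \<longlonglongrightarrow> 0"
    using c by (intro LIMSEQ_power_zero) auto
  ultimately have "?p \<le> 0"
    by (intro tendsto_lowerbound[OF _ _ sequentially_bot]) (auto simp: eventually_sequentially)
  then show "\<P>(\<xi> in R. coal_time k \<xi> > Minf) = 1"
    by (simp add: antisym)
qed

lemma nonconstant_prob_tendsto_0:
  assumes "coalescence R" "k \<le> 0"
  shows "((\<lambda>n. nonconstant_prob n k) \<longlongrightarrow> 0) at_bot"
  using nonconstant_prob_tendsto[OF assms(2)] assms by (simp add: coalescence_def)

lemma prob_diff_le_nonconstant_prob:
  assumes "n \<le> k" "k \<le> 0" "A \<in> events" "B \<in> events"
    and "\<And>\<xi>. \<xi> \<in> space R \<Longrightarrow> constant_map (flow \<xi> n k) \<Longrightarrow> \<xi> \<in> A \<longleftrightarrow> \<xi> \<in> B"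
  shows "\<bar>prob A - prob B\<bar> \<le> nonconstant_prob n k"
proof -
  let ?N = "{\<xi> \<in> space R. \<not> constant_map (flow \<xi> n k)}"
  have N: "?N \<in> events" using assms by (simp add: constant_event)
  have "prob C \<le> prob D + prob ?N" if "C \<subseteq> D \<union> ?N" "D \<in> events" for C D
    using finite_measure_mono[OF that(1)] measure_Un_le[OF that(2) N] that N by simp
  from this[of A B] this[of B A] show ?thesis
    using assms sets.sets_into_space unfolding nonconstant_prob_def by (fastforce simp: abs_le_iff)
qed

text \<open>
  The rows of \<open>x\<close> and \<open>x'\<close> are the laws of two variables that agree whenever the flow is constant.
\<close>

lemma coalescence_imp_rows_merge:
  assumes "coalescence R"
  shows "rows_merge K"
  unfolding rows_merge_def
proof (intro allI impI)
  fix k :: int and x x' z assume k: "k \<le> 0"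
  have "norm (backward_prod K n k x z - backward_prod K n k x' z) \<le> nonconstant_prob n k" if "n \<le> k" for n
    using prob_diff_le_nonconstant_prob[OF that k, of "{\<xi> \<in> space R. flow \<xi> n k x = z}"
        "{\<xi> \<in> space R. flow \<xi> n k x' = z}"]
      flow_event[OF that k, of "{h. h x = z}"] flow_event[OF that k, of "{h. h x' = z}"]
    by (auto simp: prob_flow_point[OF that k] constant_map_def)
  then have "\<forall>\<^sub>F n in at_bot. norm (backward_prod K n k x z - backward_prod K n k x' z) \<le> nonconstant_prob n k"
    by (auto simp: eventually_at_bot_linorder)
  then show "((\<lambda>n. backward_prod K n k x z - backward_prod K n k x' z) \<longlongrightarrow> 0) at_bot"
    by (rule Lim_null_comparison) (rule nonconstant_prob_tendsto_0[OF assms k])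
qed

lemma coal_map_event:
  assumes "k \<le> 0"
  shows "{\<xi> \<in> space R. coal_map k \<xi> x = z} \<in> events"
proof -
  let ?U = "\<Union>n\<in>{..<k}. {\<xi> \<in> space R. flow \<xi> n k \<in> {h. constant_map h \<and> h x = z}}"
  have U: "?U \<in> events"
    using flow_event[of _ k "{h. constant_map h \<and> h x = z}"] assms
    by (intro sets.countable_UN') auto
  have "coal_map k \<xi> x = x" if "\<not> coal_time k \<xi> > Minf" for \<xi>
    using that by (auto simp: coal_map_def split: extended.split)
  then have "\<xi> \<in> {\<xi> \<in> space R. coal_map k \<xi> x = z}
      \<longleftrightarrow> \<xi> \<in> ?U \<union> (if x = z then space R - {\<xi> \<in> space R. coal_time k \<xi> > Minf} else {})" for \<xi>
    using coal_map_eq_flow[of _ k \<xi> x]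
    by (cases "coal_time k \<xi> > Minf") (auto simp: coal_time_gt_iff, metis)
  then have "{\<xi> \<in> space R. coal_map k \<xi> x = z}
      = ?U \<union> (if x = z then space R - {\<xi> \<in> space R. coal_time k \<xi> > Minf} else {})"
    by blast
  then show ?thesis using U coal_time_event[OF assms] by auto
qed

text \<open>
  Off the event that the flow over \<open>(n, k]\<close> is not constant, the value after coalescence is the
  value of that flow.  Its law is thus the limit of the rows, which is \<open>\<pi> k\<close>.
\<close>

lemma prob_coal_map:
  assumes coal: "coalescence R" and \<pi>: "\<pi> \<in> absolute_probs K" and k: "k \<le> 0"
  shows "\<P>(\<xi> in R. coal_map k \<xi> x \<in> A) = (\<Sum>z\<in>A. \<pi> k z)"
proof -
  have point: "\<P>(\<xi> in R. coal_map k \<xi> x = z) = \<pi> k z" for z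
  proof -
    let ?p = "\<P>(\<xi> in R. coal_map k \<xi> x = z)"
    have "norm (backward_prod K n k x z - ?p) \<le> nonconstant_prob n k" if "n < k" for n
      using prob_diff_le_nonconstant_prob[of n k "{\<xi> \<in> space R. flow \<xi> n k x = z}" "{\<xi> \<in> space R. coal_map k \<xi> x = z}"]
        flow_event[of n k "{h. h x = z}"] that k
      by (auto simp: prob_flow_point coal_map_event coal_map_eq_flow)
    then have "\<forall>\<^sub>F n in at_bot. norm (backward_prod K n k x z - ?p) \<le> nonconstant_prob n k"
      unfolding eventually_at_bot_linorder by (intro exI[of _ "k - 1"]) auto
    then have "((\<lambda>n. backward_prod K n k x z - ?p) \<longlongrightarrow> 0) at_bot"
      by (rule Lim_null_comparison) (rule nonconstant_prob_tendsto_0[OF coal k])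
    then have "((\<lambda>n. backward_prod K n k x z) \<longlongrightarrow> ?p) at_bot"
      by (simp add: LIM_zero_iff)
    then show ?thesis
      using absolute_probs_limit[OF \<pi> coalescence_imp_rows_merge[OF coal] k]
      by (rule tendsto_unique[OF trivial_limit_at_bot_linorder])
  qed
  have "\<P>(\<xi> in R. coal_map k \<xi> x \<in> A) = prob (\<Union>z\<in>A. {\<xi> \<in> space R. coal_map k \<xi> x = z})"
    by (intro arg_cong[where f=prob]) auto
  also have "\<dots> = (\<Sum>z\<in>A. \<pi> k z)"
    by (subst finite_measure_finite_Union) (auto simp: coal_map_event[OF k] disjoint_family_on_def point)
  finally show ?thesis .
qed

end

section \<open>The conditional kernels\<close>

lemma phi_nonneg:
  assumes "\<forall>n\<le>0. markov_kernel (M n)" "\<forall>n\<le>0. \<forall>x y. 0 \<le> g n x y" "n \<le> 1"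
  shows "0 \<le> phi M g y n x"
  using assms(3)
proof (induction n arbitrary: x rule: int_le_induct)
  case base
  then show ?case by (simp add: phi_1)
next
  case (step i)
  then show ?case
    using assms by (simp add: phi_step) (intro sum_nonneg mult_nonneg_nonneg, auto simp: markov_kernelD)
qed

lemma markov_cond_kernel:
  assumes "\<forall>n\<le>0. markov_kernel (M n)" "\<forall>n\<le>0. \<forall>x y. 0 \<le> g n x y"
  shows "\<forall>n\<le>0. markov_kernel (cond_kernel M g y n)"
proof (intro allI impI)
  fix n :: int assume n: "n \<le> 0"
  have "prob_vector (cond_kernel M g y n x)" for x
  proof (cases "phi M g y n x > 0")
    case True
    have "(\<Sum>x'\<in>UNIV. cond_kernel M g y n x x') = phi M g y n x / phi M g y n x"
      using True n by (simp add: cond_kernel_def phi_step flip: sum_divide_distrib)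
    moreover have "0 \<le> cond_kernel M g y n x x'" for x'
      using True n assms phi_nonneg[OF assms, of "n + 1" y x']
      by (auto simp: cond_kernel_def markov_kernelD)
    ultimately show ?thesis using True by (auto simp: prob_vector_def)
  next
    case False
    then have "cond_kernel M g y n x = M n x" by (auto simp: cond_kernel_def)
    then show ?thesis using assms n by (simp add: markov_kernel_def)
  qed
  then show "markov_kernel (cond_kernel M g y n)" by (simp add: markov_kernel_def)
qed

text \<open>
  If \<open>phi\<close> vanishes at \<open>(n, x)\<close>, so does every summand of its recursion, as they are nonnegative.
  The product form thus holds at all points, also where the conditional kernel is not a quotient.
\<close>

lemma phi_mult_cond_kernel:
  assumes "\<forall>n\<le>0. markov_kernel (M n)" "\<forall>n\<le>0. \<forall>x y. 0 \<le> g n x y" "n \<le> 0"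
  shows "phi M g y n x * cond_kernel M g y n x z = M n x z * g n z (y n) * phi M g y (n + 1) z"
proof (cases "phi M g y n x > 0")
  case True
  then show ?thesis by (simp add: cond_kernel_def)
next
  case False
  then have "phi M g y n x = 0" using phi_nonneg[OF assms(1,2), of n y x] assms(3) by simp
  then have "(\<Sum>z\<in>UNIV. M n x z * g n z (y n) * phi M g y (n + 1) z) = 0"
    using assms(3) by (simp add: phi_step)
  moreover have "0 \<le> M n x z * g n z (y n) * phi M g y (n + 1) z" for z
    using assms phi_nonneg[OF assms(1,2), of "n + 1" y z] by (simp add: markov_kernelD)
  ultimately have "M n x z * g n z (y n) * phi M g y (n + 1) z = 0"
    by (subst (asm) sum_nonneg_eq_0_iff) auto
  then show ?thesis using \<open>phi M g y n x = 0\<close> by simp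
qed

lemma phi_cong:
  assumes "\<And>k. n \<le> k \<Longrightarrow> k \<le> 0 \<Longrightarrow> y k = y' k"
  shows "phi M g y n = phi M g y' n"
  unfolding phi_def using assms by (intro foldr_cong) auto

lemma cond_kernel_cong:
  assumes "\<And>k. n \<le> k \<Longrightarrow> k \<le> 0 \<Longrightarrow> y k = y' k" "n \<le> 0"
  shows "cond_kernel M g y n = cond_kernel M g y' n"
  using assms phi_cong[of n y y' M g] phi_cong[of "n + 1" y y' M g]
  by (intro ext) (simp add: cond_kernel_def)

lemma backward_prod_cong:
  assumes "\<And>j. n < j \<Longrightarrow> j \<le> k \<Longrightarrow> K j = K' j"
  shows "backward_prod K n k = backward_prod K' n k"
  unfolding backward_prod_def using assms by (intro foldr_cong) auto

text \<open>
  \<open>phi\<close> is the backward product of the weights \<open>M k u v * g k v (y k)\<close> applied to the constant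
  function one.
\<close>

lemma phi_eq_backward_prod:
  assumes "n \<le> 1"
  shows "phi M g y n x = (\<Sum>z\<in>UNIV. backward_prod (\<lambda>k u v. M k u v * g k v (y k)) (n - 1) 0 x z)"
  using assms
proof (induction n arbitrary: x rule: int_le_induct)
  case base
  then show ?case by (simp add: phi_1 backward_prod_refl kernel_id_def)
next
  case (step i)
  let ?W = "\<lambda>k u v. M k u v * g k v (y k)"
  have "phi M g y (i - 1) x = (\<Sum>v\<in>UNIV. ?W (i - 1) x v * (\<Sum>z\<in>UNIV. backward_prod ?W (i - 1) 0 v z))"
    using step by (simp add: phi_step)
  also have "\<dots> = (\<Sum>z\<in>UNIV. kernel_mult (?W (i - 1)) (backward_prod ?W (i - 1) 0) x z)"
    unfolding kernel_mult_def sum_distrib_left by (rule sum.swap)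
  also have "kernel_mult (?W (i - 1)) (backward_prod ?W (i - 1) 0) = backward_prod ?W (i - 1 - 1) 0"
    using step by (intro backward_prod_step[symmetric]) simp
  finally show ?case .
qed

section \<open>Summation over paths\<close>

lemma sum_PiE_insert:
  assumes "finite I" "i \<notin> I"
  shows "(\<Sum>x\<in>PiE (insert i I) (\<lambda>_. UNIV). f x)
    = (\<Sum>u\<in>(UNIV :: 'e::finite set). \<Sum>x\<in>PiE I (\<lambda>_. UNIV). f (x(i := u)))"
  unfolding PiE_insert_eq using inj_combinator[OF assms(2), of "\<lambda>_. UNIV"]
  by (subst sum.reindex) (auto simp: sum.cartesian_product case_prod_beta)

text \<open>
  The first state is summed out repeatedly and absorbed into the initial weights \<open>a\<close>.
\<close>

lemma path_sum:
  fixes W :: "int \<Rightarrow> 'e::finite \<Rightarrow> 'e \<Rightarrow> real"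
  assumes "m \<le> 0"
  shows "(\<Sum>x\<in>PiE {m..0} (\<lambda>_. UNIV). a (x m) * (\<Prod>k\<in>{m + 1..0}. W k (x (k - 1)) (x k)))
    = (\<Sum>u\<in>UNIV. a u * (\<Sum>z\<in>UNIV. backward_prod W m 0 u z))"
  using assms
proof (induction m arbitrary: a rule: int_le_induct)
  case base
  have "(\<Sum>x\<in>PiE (insert (0::int) {}) (\<lambda>_. UNIV). a (x 0)) = (\<Sum>u\<in>UNIV. a u)"
    by (subst sum_PiE_insert) auto
  then show ?case by (simp add: backward_prod_refl kernel_id_def)
next
  case (step i)
  define a' where "a' v = (\<Sum>u\<in>UNIV. a u * W i u v)" for v
  have R: "(\<Sum>v\<in>UNIV. W i u v * (\<Sum>z\<in>UNIV. backward_prod W i 0 v z))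
      = (\<Sum>z\<in>UNIV. backward_prod W (i - 1) 0 u z)" for u
    unfolding backward_prod_step[OF step.hyps] kernel_mult_def sum_distrib_left by (rule sum.swap)
  have I: "{i - 1..0} = insert (i - 1) {i..0}" and J: "{i..0} = insert i {i + 1..0}"
    using step by auto
  have "(\<Sum>x\<in>PiE {i - 1..0} (\<lambda>_. UNIV). a (x (i - 1)) * (\<Prod>k\<in>{i..0}. W k (x (k - 1)) (x k)))
      = (\<Sum>u\<in>UNIV. \<Sum>x\<in>PiE {i..0} (\<lambda>_. UNIV).
          a u * (W i u (x i) * (\<Prod>k\<in>{i + 1..0}. W k (x (k - 1)) (x k))))"
    unfolding I by (subst sum_PiE_insert) (auto simp: J intro!: sum.cong prod.cong)
  also have "\<dots> = (\<Sum>x\<in>PiE {i..0} (\<lambda>_. UNIV). a' (x i) * (\<Prod>k\<in>{i + 1..0}. W k (x (k - 1)) (x k)))"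
    unfolding a'_def by (subst sum.swap) (simp add: sum_distrib_right mult.assoc)
  also have "\<dots> = (\<Sum>v\<in>UNIV. a' v * (\<Sum>z\<in>UNIV. backward_prod W i 0 v z))"
    by (rule step.IH)
  also have "\<dots> = (\<Sum>u\<in>UNIV. a u * (\<Sum>v\<in>UNIV. W i u v * (\<Sum>z\<in>UNIV. backward_prod W i 0 v z)))"
    unfolding a'_def sum_distrib_right sum_distrib_left[of "a _"] mult.assoc by (rule sum.swap)
  finally show ?case by (simp add: R)
qed

text \<open>
  Summing out the states after time \<open>n\<close> leaves \<open>\<phi>\<^sub>n\<^sub>+\<^sub>1\<close>; summing out the state at time \<open>n\<close> as well
  leaves \<open>\<phi>\<^sub>n\<close>, a function of the state at time \<open>n - 1\<close>.  The conditional kernel divides \<open>\<phi>\<^sub>n\<close> among the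
  possible states at time \<open>n\<close>.
\<close>

lemma path_sum_cond_kernel:
  fixes M :: "int \<Rightarrow> 'e::finite \<Rightarrow> 'e \<Rightarrow> real" and a :: "'e \<Rightarrow> real" and y :: "int \<Rightarrow> 'f"
  assumes "\<forall>n\<le>0. markov_kernel (M n)" "\<forall>n\<le>0. \<forall>x y. 0 \<le> g n x y" "m < n" "n \<le> 0"
  defines "D \<equiv> \<lambda>x. a (x m) * (\<Prod>k\<in>{m + 1..0}. M k (x (k - 1)) (x k) * g k (x k) (y k))"
  shows "(\<Sum>x\<in>PiE {m..0} (\<lambda>_. UNIV). D x * (if x n = z then 1 else 0))
    = (\<Sum>x\<in>PiE {m..0} (\<lambda>_. UNIV). D x * cond_kernel M g y n (x (n - 1)) z)"
proof -
  define W where "W k u v = M k u v * g k v (y k)" for k u v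
  \<comment> \<open>the weights with a factor \<open>q\<close> of the states at times \<open>n - 1\<close> and \<open>n\<close> inserted; both sides have this form\<close>
  define W' where "W' q k u v = (if k = n then W k u v * q u v else W k u v)" for q k u v
  have W'n: "W' q n u v = W n u v * q u v" for q u v by (simp add: W'_def)
  have Wphi: "(\<Sum>t\<in>UNIV. backward_prod W n 0 w t) = phi M g y (n + 1) w" for w
    using phi_eq_backward_prod[of "n + 1" M g y w] assms by (simp add: W_def[abs_def])
  have m0: "m \<le> 0" using assms by simp
  have D: "(\<Sum>x\<in>PiE {m..0} (\<lambda>_. UNIV). D x * q (x (n - 1)) (x n))
      = (\<Sum>u\<in>UNIV. a u * (\<Sum>v\<in>UNIV. backward_prod W m (n - 1) u v *
          (\<Sum>w\<in>UNIV. W n v w * q v w * phi M g y (n + 1) w)))" for q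
  proof -
    have R: "(\<Sum>t\<in>UNIV. backward_prod (W' q) m 0 u t) = (\<Sum>v\<in>UNIV. backward_prod W m (n - 1) u v *
          (\<Sum>w\<in>UNIV. W n v w * q v w * phi M g y (n + 1) w))" for u
    proof -
      have "backward_prod (W' q) m 0
          = kernel_mult (backward_prod (W' q) m (n - 1)) (kernel_mult (W' q n) (backward_prod (W' q) n 0))"
        using backward_prod_comp[of m "n - 1" 0 "W' q"] assms by (simp add: backward_prod_step)
      also have "backward_prod (W' q) m (n - 1) = backward_prod W m (n - 1)"
        by (intro backward_prod_cong) (auto simp: W'_def fun_eq_iff)
      also have "backward_prod (W' q) n 0 = backward_prod W n 0"
        by (intro backward_prod_cong) (auto simp: W'_def fun_eq_iff)
      finally have "(\<Sum>t\<in>UNIV. backward_prod (W' q) m 0 u t)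
          = (\<Sum>t\<in>UNIV. \<Sum>v\<in>UNIV. backward_prod W m (n - 1) u v *
              (\<Sum>w\<in>UNIV. W n v w * q v w * backward_prod W n 0 w t))"
        by (simp add: kernel_mult_def W'n)
      also have "\<dots> = (\<Sum>v\<in>UNIV. \<Sum>t\<in>UNIV. backward_prod W m (n - 1) u v *
              (\<Sum>w\<in>UNIV. W n v w * q v w * backward_prod W n 0 w t))"
        by (rule sum.swap)
      also have "\<dots> = (\<Sum>v\<in>UNIV. backward_prod W m (n - 1) u v *
              (\<Sum>w\<in>UNIV. W n v w * q v w * (\<Sum>t\<in>UNIV. backward_prod W n 0 w t)))"
        unfolding sum_distrib_left[of "W _ _ _ * _"] sum_distrib_left[of "backward_prod W m _ _ _", symmetric]
        by (intro sum.cong refl arg_cong2[where f="(*)"] sum.swap)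
      finally show ?thesis by (simp only: Wphi)
    qed
    have n: "n \<in> {m + 1..0}" using assms by simp
    have "(\<Prod>k\<in>{m + 1..0}. W' q k (x (k - 1)) (x k))
        = (\<Prod>k\<in>{m + 1..0}. W k (x (k - 1)) (x k)) * q (x (n - 1)) (x n)" for x
    proof -
      have "(\<Prod>k\<in>{m + 1..0} - {n}. W' q k (x (k - 1)) (x k)) = (\<Prod>k\<in>{m + 1..0} - {n}. W k (x (k - 1)) (x k))"
        by (intro prod.cong) (auto simp: W'_def)
      then show ?thesis
        using prod.remove[OF _ n, of "\<lambda>k. W' q k (x (k - 1)) (x k)"]
          prod.remove[OF _ n, of "\<lambda>k. W k (x (k - 1)) (x k)"] by (simp add: W'_def)
    qed
    then have "(\<Sum>x\<in>PiE {m..0} (\<lambda>_. UNIV). D x * q (x (n - 1)) (x n))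
        = (\<Sum>x\<in>PiE {m..0} (\<lambda>_. UNIV). a (x m) * (\<Prod>k\<in>{m + 1..0}. W' q k (x (k - 1)) (x k)))"
      by (simp add: D_def W_def mult.assoc)
    also have "\<dots> = (\<Sum>u\<in>UNIV. a u * (\<Sum>t\<in>UNIV. backward_prod (W' q) m 0 u t))"
      by (rule path_sum[OF m0])
    also have "\<dots> = (\<Sum>u\<in>UNIV. a u * (\<Sum>v\<in>UNIV. backward_prod W m (n - 1) u v *
          (\<Sum>w\<in>UNIV. W n v w * q v w * phi M g y (n + 1) w)))"
      by (simp only: R)
    finally show ?thesis .
  qed
  have "(\<Sum>w\<in>UNIV. W n v w * (if w = z then 1 else 0) * phi M g y (n + 1) w)
      = (\<Sum>w\<in>UNIV. W n v w * cond_kernel M g y n v z * phi M g y (n + 1) w)" for v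
  proof -
    have "(\<Sum>w\<in>UNIV. W n v w * (if w = z then 1 else 0) * phi M g y (n + 1) w)
        = (\<Sum>w\<in>UNIV. if w = z then W n v w * phi M g y (n + 1) w else 0)"
      by (intro sum.cong) auto
    also have "\<dots> = phi M g y n v * cond_kernel M g y n v z"
      using phi_mult_cond_kernel[OF assms(1,2,4), of y v z] by (simp add: W_def)
    also have "\<dots> = (\<Sum>w\<in>UNIV. W n v w * cond_kernel M g y n v z * phi M g y (n + 1) w)"
      using assms(4) by (simp add: phi_step W_def sum_distrib_left sum_distrib_right algebra_simps)
    finally show ?thesis .
  qed
  then show ?thesis
    using D[of "\<lambda>_ w. if w = z then 1 else 0"] D[of "\<lambda>u _. cond_kernel M g y n u z"] by simp
qed

text \<open>
  Fubini's theorem separates the discrete first components, over which integration is summation over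
  paths, from the second ones.
\<close>

lemma nn_integral_PiM_finite_times:
  fixes f :: "('i \<Rightarrow> 'e::finite \<times> 'f) \<Rightarrow> ennreal"
  assumes N: "sigma_finite_measure N" and "finite I"
    and "f \<in> borel_measurable (PiM I (\<lambda>_. count_space UNIV \<Otimes>\<^sub>M N))"
  shows "(\<integral>\<^sup>+w. f w \<partial>PiM I (\<lambda>_. count_space UNIV \<Otimes>\<^sub>M N))
    = (\<integral>\<^sup>+y. (\<Sum>x\<in>PiE I (\<lambda>_. UNIV). f (\<lambda>i\<in>I. (x i, y i))) \<partial>PiM I (\<lambda>_. N))"
  using assms(2,3)
proof (induction I arbitrary: f rule: finite_induct)
  case empty
  then show ?case by (simp add: PiM_empty nn_integral_count_space_finite restrict_def)
next
  case (insert i I)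
  let ?E = "count_space (UNIV :: 'e set)"
  interpret N: sigma_finite_measure N by fact
  interpret E: sigma_finite_measure ?E by (simp add: sigma_finite_measure_count_space_finite)
  interpret EN: product_sigma_finite "\<lambda>_ :: 'i. ?E \<Otimes>\<^sub>M N"
    by unfold_locales (intro sigma_finite_measure.sigma_finite_countable sigma_finite_pair_measure N E.sigma_finite_measure_axioms)
  interpret NN: product_sigma_finite "\<lambda>_ :: 'i. N"
    by unfold_locales (rule N.sigma_finite_countable)
  note [measurable] = insert.prems
  have upd [measurable]: "(\<lambda>(w, u, v). f (w(i := (u, v)))) \<in> borel_measurable (PiM I (\<lambda>_. ?E \<Otimes>\<^sub>M N) \<Otimes>\<^sub>M (?E \<Otimes>\<^sub>M N))"
  proof -
    have "(\<lambda>p. (fst p)(i := snd p)) \<in> PiM I (\<lambda>_. ?E \<Otimes>\<^sub>M N) \<Otimes>\<^sub>M (?E \<Otimes>\<^sub>M N) \<rightarrow>\<^sub>M PiM (insert i I) (\<lambda>_. ?E \<Otimes>\<^sub>M N)"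
      by measurable
    from measurable_compose[OF this insert.prems] show ?thesis by (simp add: case_prod_beta')
  qed
  have pt: "(\<lambda>y. f (\<lambda>j\<in>insert i I. (x j, y j))) \<in> borel_measurable (PiM (insert i I) (\<lambda>_. N))" for x
    by (rule measurable_compose[OF _ insert.prems], rule measurable_restrict) measurable
  define h where "h w = (\<Sum>u\<in>UNIV. \<integral>\<^sup>+v. f (w(i := (u, v))) \<partial>N)" for w
  have slice: "(\<lambda>(w, v). f (w(i := (u, v)))) \<in> borel_measurable (PiM I (\<lambda>_. ?E \<Otimes>\<^sub>M N) \<Otimes>\<^sub>M N)" for u
  proof -
    have "(\<lambda>p. (fst p, u, snd p)) \<in> PiM I (\<lambda>_. ?E \<Otimes>\<^sub>M N) \<Otimes>\<^sub>M N \<rightarrow>\<^sub>M PiM I (\<lambda>_. ?E \<Otimes>\<^sub>M N) \<Otimes>\<^sub>M (?E \<Otimes>\<^sub>M N)"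
      by measurable
    from measurable_compose[OF this upd] show ?thesis by (simp add: case_prod_beta')
  qed
  have h_meas: "h \<in> borel_measurable (PiM I (\<lambda>_. ?E \<Otimes>\<^sub>M N))"
    unfolding h_def using slice by (intro borel_measurable_sum N.borel_measurable_nn_integral) auto
  have "(\<integral>\<^sup>+w. f w \<partial>PiM (insert i I) (\<lambda>_. ?E \<Otimes>\<^sub>M N))
      = (\<integral>\<^sup>+w. (\<integral>\<^sup>+p. f (w(i := p)) \<partial>(?E \<Otimes>\<^sub>M N)) \<partial>PiM I (\<lambda>_. ?E \<Otimes>\<^sub>M N))"
    using insert by (intro EN.product_nn_integral_insert) auto
  also have "\<dots> = (\<integral>\<^sup>+w. h w \<partial>PiM I (\<lambda>_. ?E \<Otimes>\<^sub>M N))"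
  proof (rule nn_integral_cong)
    fix w assume "w \<in> space (PiM I (\<lambda>_. ?E \<Otimes>\<^sub>M N))"
    then have "(\<lambda>p. f (w(i := p))) \<in> borel_measurable (?E \<Otimes>\<^sub>M N)"
      using measurable_Pair2[OF upd, of w] by (simp add: case_prod_beta')
    then have "(\<integral>\<^sup>+p. f (w(i := p)) \<partial>(?E \<Otimes>\<^sub>M N)) = (\<integral>\<^sup>+u. \<integral>\<^sup>+v. f (w(i := (u, v))) \<partial>N \<partial>?E)"
      by (rule N.nn_integral_fst[symmetric])
    then show "(\<integral>\<^sup>+p. f (w(i := p)) \<partial>(?E \<Otimes>\<^sub>M N)) = h w"
      by (simp add: h_def nn_integral_count_space_finite)
  qed
  also have "\<dots> = (\<integral>\<^sup>+y. (\<Sum>x\<in>PiE I (\<lambda>_. UNIV). h (\<lambda>j\<in>I. (x j, y j))) \<partial>PiM I (\<lambda>_. N))"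
    by (rule insert.IH[OF h_meas])
  also have "\<dots> = (\<integral>\<^sup>+y. \<integral>\<^sup>+v. (\<Sum>x\<in>PiE (insert i I) (\<lambda>_. UNIV). f (\<lambda>j\<in>insert i I. (x j, (y(i := v)) j))) \<partial>N \<partial>PiM I (\<lambda>_. N))"
  proof (rule nn_integral_cong)
    fix y assume y: "y \<in> space (PiM I (\<lambda>_. N))"
    have eq: "(\<lambda>j\<in>insert i I. ((x(i := u)) j, (y(i := v)) j)) = (\<lambda>j\<in>I. (x j, y j))(i := (u, v))" for x u v
      by (auto simp: fun_eq_iff)
    have m: "(\<lambda>v. f (\<lambda>j\<in>insert i I. (x j, (y(i := v)) j))) \<in> borel_measurable N" for x
      using y by (intro measurable_compose[OF _ pt] measurable_fun_upd[where J=I]) auto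
    have "(\<integral>\<^sup>+v. (\<Sum>x\<in>PiE (insert i I) (\<lambda>_. UNIV). f (\<lambda>j\<in>insert i I. (x j, (y(i := v)) j))) \<partial>N)
        = (\<Sum>x\<in>PiE (insert i I) (\<lambda>_. UNIV). \<integral>\<^sup>+v. f (\<lambda>j\<in>insert i I. (x j, (y(i := v)) j)) \<partial>N)"
      by (rule nn_integral_sum) (rule m)
    also have "\<dots> = (\<Sum>u\<in>UNIV. \<Sum>x\<in>PiE I (\<lambda>_. UNIV). \<integral>\<^sup>+v. f ((\<lambda>j\<in>I. (x j, y j))(i := (u, v))) \<partial>N)"
      unfolding sum_PiE_insert[OF insert.hyps] eq ..
    also have "\<dots> = (\<Sum>x\<in>PiE I (\<lambda>_. UNIV). h (\<lambda>j\<in>I. (x j, y j)))"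
      unfolding h_def by (rule sum.swap)
    finally show "(\<Sum>x\<in>PiE I (\<lambda>_. UNIV). h (\<lambda>j\<in>I. (x j, y j)))
        = (\<integral>\<^sup>+v. (\<Sum>x\<in>PiE (insert i I) (\<lambda>_. UNIV). f (\<lambda>j\<in>insert i I. (x j, (y(i := v)) j))) \<partial>N)" ..
  qed
  also have "\<dots> = (\<integral>\<^sup>+y. (\<Sum>x\<in>PiE (insert i I) (\<lambda>_. UNIV). f (\<lambda>j\<in>insert i I. (x j, y j))) \<partial>PiM (insert i I) (\<lambda>_. N))"
    using insert.hyps pt by (intro NN.product_nn_integral_insert[symmetric] borel_measurable_sum) auto
  finally show ?case .
qed

section \<open>The law of the hidden chain given the observations\<close>

lemma measurable_kernel_entry:
  fixes M :: "'e::finite \<Rightarrow> 'e \<Rightarrow> real"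
  assumes "f \<in> N \<rightarrow>\<^sub>M count_space UNIV" "h \<in> N \<rightarrow>\<^sub>M count_space UNIV"
  shows "(\<lambda>w. M (f w) (h w)) \<in> borel_measurable N"
proof -
  have "case_prod M \<in> borel_measurable (count_space UNIV \<Otimes>\<^sub>M count_space UNIV)"
    by (intro measurable_pair_measure_countable1) auto
  from measurable_compose[OF measurable_Pair[OF assms] this] show ?thesis by simp
qed

lemma measurable_density_entry:
  fixes g :: "'e::finite \<Rightarrow> 'f \<Rightarrow> real"
  assumes "\<forall>x. g x \<in> borel_measurable B" "f \<in> N \<rightarrow>\<^sub>M count_space UNIV" "h \<in> N \<rightarrow>\<^sub>M B"
  shows "(\<lambda>w. g (f w) (h w)) \<in> borel_measurable N"
proof -
  have "case_prod g \<in> borel_measurable (count_space UNIV \<Otimes>\<^sub>M B)"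
    using assms(1) by (intro measurable_pair_measure_countable1) auto
  from measurable_compose[OF measurable_Pair[OF assms(2,3)] this] show ?thesis by simp
qed

locale hidden_markov =
  fixes M :: "int \<Rightarrow> 'e::finite \<Rightarrow> 'e \<Rightarrow> real"
    and g :: "int \<Rightarrow> 'e \<Rightarrow> 'f::polish_space \<Rightarrow> real"
    and \<psi> :: "'f measure"
    and \<pi> :: "int \<Rightarrow> 'e \<Rightarrow> real"
    and P :: "((int \<Rightarrow> 'e) \<times> (int \<Rightarrow> 'f)) measure"
  assumes M: "\<forall>n\<le>0. markov_kernel (M n)"
    and \<psi>: "sets \<psi> = sets borel" "sigma_finite_measure \<psi>"
    and g_meas: "\<forall>n\<le>0. \<forall>x. g n x \<in> borel_measurable borel"
    and g_nonneg: "\<forall>n\<le>0. \<forall>x y. 0 \<le> g n x y"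
    and \<pi>: "\<pi> \<in> absolute_probs M"
    and P: "hmm_measure M g \<psi> \<pi> P"
begin

sublocale prob_space P
  using P by (simp add: hmm_measure_def)

lemma sets_P [measurable_cong]: "sets P = sets (path_X \<Otimes>\<^sub>M path_Y)"
  using P by (simp add: hmm_measure_def)

lemma snd_measurable [measurable]: "snd \<in> P \<rightarrow>\<^sub>M path_Y"
  by measurable

lemma coord_X_measurable:
  assumes "n \<le> 0"
  shows "coord_X n \<in> P \<rightarrow>\<^sub>M count_space UNIV"
proof -
  have "(\<lambda>x. x n) \<in> path_X \<rightarrow>\<^sub>M count_space (UNIV :: 'e set)"
    unfolding path_X_def using assms by (intro measurable_component_singleton) simp
  then have "(\<lambda>\<omega>. fst \<omega> n) \<in> P \<rightarrow>\<^sub>M count_space UNIV" by measurable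
  then show ?thesis by (simp add: coord_X_def[abs_def])
qed

lemma coord_Y_measurable:
  assumes "n \<le> 0"
  shows "coord_Y n \<in> P \<rightarrow>\<^sub>M borel"
proof -
  have "(\<lambda>y. y n) \<in> path_Y \<rightarrow>\<^sub>M (borel :: 'f measure)"
    unfolding path_Y_def using assms by (intro measurable_component_singleton) simp
  then have "(\<lambda>\<omega>. snd \<omega> n) \<in> P \<rightarrow>\<^sub>M borel" by measurable
  then show ?thesis by (simp add: coord_Y_def[abs_def])
qed

lemma phi_measurable:
  assumes L: "\<And>k. n \<le> k \<Longrightarrow> k \<le> 0 \<Longrightarrow> (\<lambda>w. y w k) \<in> L \<rightarrow>\<^sub>M borel" and "n \<le> 1"
  shows "(\<lambda>w. phi M g (y w) n x) \<in> borel_measurable L"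
  using assms(2,1)
proof (induction n arbitrary: x rule: int_le_induct)
  case base
  then show ?case by (simp add: phi_1)
next
  case (step i)
  have "(\<lambda>w. g (i - 1) x' (y w (i - 1))) \<in> borel_measurable L" for x'
    using step g_meas by (intro measurable_compose[OF step.prems[of "i - 1"]]) auto
  then have "(\<lambda>w. \<Sum>x'\<in>UNIV. M (i - 1) x x' * g (i - 1) x' (y w (i - 1)) * phi M g (y w) i x')
      \<in> borel_measurable L"
    using step by (intro borel_measurable_sum borel_measurable_times) auto
  then show ?case using step by (simp add: phi_step)
qed

lemma cond_kernel_measurable:
  assumes L: "\<And>k. n \<le> k \<Longrightarrow> k \<le> 0 \<Longrightarrow> (\<lambda>w. y w k) \<in> L \<rightarrow>\<^sub>M borel" and n: "n \<le> 0"
  shows "(\<lambda>w. cond_kernel M g (y w) n x z) \<in> borel_measurable L"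
proof -
  have [measurable]: "(\<lambda>w. phi M g (y w) n x) \<in> borel_measurable L"
    "(\<lambda>w. phi M g (y w) (n + 1) z) \<in> borel_measurable L"
    using assms by (auto intro!: phi_measurable)
  have [measurable]: "(\<lambda>w. g n z (y w n)) \<in> borel_measurable L"
    using n g_meas by (intro measurable_compose[OF L[of n]]) auto
  show ?thesis unfolding cond_kernel_def by measurable
qed

lemma cond_kernel_bounds:
  assumes "n \<le> 0"
  shows "0 \<le> cond_kernel M g y n x z" "cond_kernel M g y n x z \<le> 1"
  using markov_cond_kernel[OF M g_nonneg] assms by (auto simp: markov_kernelD)

definition path_density :: "int \<Rightarrow> (int \<Rightarrow> 'e) \<Rightarrow> (int \<Rightarrow> 'f) \<Rightarrow> real" where
  "path_density m x y = \<pi> m (x m) * g m (x m) (y m) *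
     (\<Prod>k\<in>{m + 1..0}. M k (x (k - 1)) (x k) * g k (x k) (y k))"

lemma path_density_nonneg: "m \<le> 0 \<Longrightarrow> 0 \<le> path_density m x y"
  unfolding path_density_def using M g_nonneg absolute_probsD(1)[OF \<pi>]
  by (intro mult_nonneg_nonneg prod_nonneg) (auto simp: markov_kernelD)

text \<open>
  The density of the window \<open>{m..0}\<close> turns expectations under \<open>P\<close> into integrals over the observations
  of sums over paths of states.
\<close>

lemma nn_integral_window:
  assumes m: "m \<le> 0"
    and h: "h \<in> borel_measurable (PiM {m..0} (\<lambda>_. count_space UNIV \<Otimes>\<^sub>M borel))"
  shows "(\<integral>\<^sup>+\<omega>. h (\<lambda>k\<in>{m..0}. (coord_X k \<omega>, coord_Y k \<omega>)) \<partial>P)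
    = (\<integral>\<^sup>+y. (\<Sum>x\<in>PiE {m..0} (\<lambda>_. UNIV). ennreal (path_density m x y) * h (\<lambda>k\<in>{m..0}. (x k, y k)))
        \<partial>PiM {m..0} (\<lambda>_. \<psi>))"
proof -
  let ?B = "PiM {m..0} (\<lambda>_. count_space UNIV \<Otimes>\<^sub>M borel) :: (int \<Rightarrow> 'e \<times> 'f) measure"
  let ?N = "PiM {m..0} (\<lambda>_. count_space UNIV \<Otimes>\<^sub>M \<psi>) :: (int \<Rightarrow> 'e \<times> 'f) measure"
  let ?d = "\<lambda>w. path_density m (\<lambda>k. fst (w k)) (\<lambda>k. snd (w k))"
  have sets_N: "sets ?N = sets ?B"
    by (intro sets_PiM_cong sets_pair_measure_cong) (auto simp: \<psi>)
  have X: "(\<lambda>w. fst (w k)) \<in> ?N \<rightarrow>\<^sub>M count_space UNIV" and Y: "(\<lambda>w. snd (w k)) \<in> ?N \<rightarrow>\<^sub>M borel"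
    if "k \<in> {m..0}" for k
    using measurable_component_singleton[OF that, of "\<lambda>_. count_space UNIV \<Otimes>\<^sub>M borel"]
    unfolding measurable_cong_sets[OF sets_N refl] by measurable
  have gk: "(\<lambda>w. g k (fst (w k)) (snd (w k))) \<in> borel_measurable ?N" if "k \<in> {m..0}" for k
    using g_meas that by (intro measurable_density_entry[OF _ X Y]) auto
  have Mk: "(\<lambda>w. M k (fst (w (k - 1))) (fst (w k))) \<in> borel_measurable ?N" if "k \<in> {m + 1..0}" for k
    using that by (intro measurable_kernel_entry X) auto
  have "(\<lambda>w. \<pi> m (fst (w m))) \<in> borel_measurable ?N"
    using m by (intro measurable_compose[OF X]) auto
  then have d: "?d \<in> borel_measurable ?N"
    unfolding path_density_def using m
    by (intro borel_measurable_times borel_measurable_prod gk Mk) auto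
  have dxy: "?d (\<lambda>k\<in>{m..0}. (x k, y k)) = path_density m x y" for x y
    using m unfolding path_density_def by (auto intro!: arg_cong2[where f="(*)"] prod.cong)
  have L: "hmm_law M g \<psi> \<pi> m = density ?N (\<lambda>w. ennreal (?d w))"
    by (simp add: hmm_law_def path_density_def)
  have h': "h \<in> borel_measurable ?N"
    using h unfolding measurable_cong_sets[OF sets_N refl] .
  have W: "(\<lambda>\<omega>. \<lambda>k\<in>{m..0}. (coord_X k \<omega>, coord_Y k \<omega>)) \<in> P \<rightarrow>\<^sub>M ?B"
    by (intro measurable_restrict measurable_Pair coord_X_measurable coord_Y_measurable) auto
  have "(\<integral>\<^sup>+\<omega>. h (\<lambda>k\<in>{m..0}. (coord_X k \<omega>, coord_Y k \<omega>)) \<partial>P)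
      = (\<integral>\<^sup>+w. h w \<partial>distr P ?B (\<lambda>\<omega>. \<lambda>k\<in>{m..0}. (coord_X k \<omega>, coord_Y k \<omega>)))"
    by (rule nn_integral_distr[OF W, symmetric]) (use h in auto)
  also have "\<dots> = (\<integral>\<^sup>+w. h w \<partial>hmm_law M g \<psi> \<pi> m)"
    using P m by (simp add: hmm_measure_def)
  also have "\<dots> = (\<integral>\<^sup>+w. ennreal (?d w) * h w \<partial>?N)"
    unfolding L using d h' by (intro nn_integral_density) auto
  also have "\<dots> = (\<integral>\<^sup>+y. (\<Sum>x\<in>PiE {m..0} (\<lambda>_. UNIV).
      ennreal (?d (\<lambda>k\<in>{m..0}. (x k, y k))) * h (\<lambda>k\<in>{m..0}. (x k, y k))) \<partial>PiM {m..0} (\<lambda>_. \<psi>))"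
    using d h' by (intro nn_integral_PiM_finite_times \<psi>) auto
  finally show ?thesis by (simp only: dxy)
qed

text \<open>
  For events that depend on the observations at finitely many times, the window is chosen to contain
  these times and \<open>n - 1\<close>.  The two integrands then agree for each value of the observations by
  \<open>path_sum_cond_kernel\<close>.
\<close>

lemma smoothing_step_cylinder:
  assumes n: "n \<le> 0" and J: "finite J" "J \<subseteq> {..0}" and A: "\<And>j. j \<in> J \<Longrightarrow> A j \<in> sets borel"
  shows "(\<integral>\<^sup>+\<omega>. ennreal (if coord_X n \<omega> = z then 1 else 0) * (\<Prod>j\<in>J. indicator (A j) (coord_Y j \<omega>)) \<partial>P)
    = (\<integral>\<^sup>+\<omega>. ennreal (cond_kernel M g (snd \<omega>) n (coord_X (n - 1) \<omega>) z) * (\<Prod>j\<in>J. indicator (A j) (coord_Y j \<omega>)) \<partial>P)"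
proof -
  define m where "m = Min (insert (n - 1) J)"
  have m: "m < n" "m \<le> 0" "J \<subseteq> {m..0}"
  proof -
    have "m \<le> n - 1" unfolding m_def using J by (intro Min_le) auto
    then show "m < n" "m \<le> 0" using n by auto
    show "J \<subseteq> {m..0}" unfolding m_def using J by auto
  qed
  let ?B = "PiM {m..0} (\<lambda>_. count_space UNIV \<Otimes>\<^sub>M borel) :: (int \<Rightarrow> 'e \<times> 'f) measure"
  define c where "c w = (\<Prod>j\<in>J. indicator (A j) (snd (w j)) :: ennreal)" for w :: "int \<Rightarrow> 'e \<times> 'f"
  define h1 where "h1 w = ennreal (if fst (w n) = z then 1 else 0) * c w" for w
  define h2 where "h2 w = ennreal (cond_kernel M g (\<lambda>k. snd (w k)) n (fst (w (n - 1))) z) * c w" for w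
  have X: "(\<lambda>w. fst (w k)) \<in> ?B \<rightarrow>\<^sub>M count_space UNIV" and Y: "(\<lambda>w. snd (w k)) \<in> ?B \<rightarrow>\<^sub>M borel"
    if "k \<in> {m..0}" for k
    using measurable_component_singleton[OF that, of "\<lambda>_. count_space UNIV \<Otimes>\<^sub>M borel"] by measurable
  have c: "c \<in> borel_measurable ?B"
    unfolding c_def using A m
    by (intro borel_measurable_prod_ennreal measurable_compose[OF Y] borel_measurable_indicator) auto
  have h1: "h1 \<in> borel_measurable ?B"
    unfolding h1_def using m n
    by (intro borel_measurable_times_ennreal c measurable_compose[OF X[of n]]) auto
  have "(\<lambda>w. \<Sum>u\<in>UNIV. (if fst (w (n - 1)) = u then 1 else 0) * cond_kernel M g (\<lambda>k. snd (w k)) n u z)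
      \<in> borel_measurable ?B"
    using m n
    by (intro borel_measurable_sum borel_measurable_times measurable_compose[OF X[of "n - 1"]]
        cond_kernel_measurable Y) auto
  then have ck: "(\<lambda>w. cond_kernel M g (\<lambda>k. snd (w k)) n (fst (w (n - 1))) z) \<in> borel_measurable ?B"
    by (simp add: if_distrib[of "\<lambda>t. t * _"] cong: if_cong)
  have h2: "h2 \<in> borel_measurable ?B"
    unfolding h2_def using ck c by (intro borel_measurable_times_ennreal) auto
  have ckw: "cond_kernel M g (\<lambda>k. snd ((\<lambda>k\<in>{m..0}. (x k, y k)) k)) n = cond_kernel M g y n" for x :: "int \<Rightarrow> 'e" and y
    using m n by (intro cond_kernel_cong) auto
  have cw: "c (\<lambda>k\<in>{m..0}. (x k, y k)) = (\<Prod>j\<in>J. indicator (A j) (y j))" for x y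
    unfolding c_def using m by (intro prod.cong) auto
  have "(\<integral>\<^sup>+\<omega>. ennreal (if coord_X n \<omega> = z then 1 else 0) * (\<Prod>j\<in>J. indicator (A j) (coord_Y j \<omega>)) \<partial>P)
      = (\<integral>\<^sup>+\<omega>. h1 (\<lambda>k\<in>{m..0}. (coord_X k \<omega>, coord_Y k \<omega>)) \<partial>P)"
    unfolding h1_def cw using m n by simp
  also have "\<dots> = (\<integral>\<^sup>+y. (\<Sum>x\<in>PiE {m..0} (\<lambda>_. UNIV). ennreal (path_density m x y) * h1 (\<lambda>k\<in>{m..0}. (x k, y k)))
        \<partial>PiM {m..0} (\<lambda>_. \<psi>))"
    by (rule nn_integral_window[OF m(2) h1])
  also have "\<dots> = (\<integral>\<^sup>+y. (\<Sum>x\<in>PiE {m..0} (\<lambda>_. UNIV). ennreal (path_density m x y) * h2 (\<lambda>k\<in>{m..0}. (x k, y k)))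
        \<partial>PiM {m..0} (\<lambda>_. \<psi>))"
  proof (rule nn_integral_cong)
    fix y :: "int \<Rightarrow> 'f"
    let ?c = "\<Prod>j\<in>J. indicator (A j) (y j) :: ennreal"
    have "(\<Sum>x\<in>PiE {m..0} (\<lambda>_. UNIV). ennreal (path_density m x y) * h1 (\<lambda>k\<in>{m..0}. (x k, y k)))
        = (\<Sum>x\<in>PiE {m..0} (\<lambda>_. UNIV). ennreal (path_density m x y * (if x n = z then 1 else 0))) * ?c"
      unfolding h1_def cw sum_distrib_right using m n path_density_nonneg[OF m(2)]
      by (intro sum.cong) (auto simp: ennreal_mult' mult.assoc)
    also have "\<dots> = ennreal (\<Sum>x\<in>PiE {m..0} (\<lambda>_. UNIV). path_density m x y * (if x n = z then 1 else 0)) * ?c"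
      using path_density_nonneg[OF m(2)] by (subst sum_ennreal) auto
    also have "\<dots> = ennreal (\<Sum>x\<in>PiE {m..0} (\<lambda>_. UNIV). path_density m x y * cond_kernel M g y n (x (n - 1)) z) * ?c"
      unfolding path_density_def
      using path_sum_cond_kernel[OF M g_nonneg m(1) n, of "\<lambda>u. \<pi> m u * g m u (y m)" y z] by simp
    also have "\<dots> = (\<Sum>x\<in>PiE {m..0} (\<lambda>_. UNIV). ennreal (path_density m x y * cond_kernel M g y n (x (n - 1)) z)) * ?c"
      using path_density_nonneg[OF m(2)] cond_kernel_bounds[OF n] by (subst sum_ennreal) auto
    also have "\<dots> = (\<Sum>x\<in>PiE {m..0} (\<lambda>_. UNIV). ennreal (path_density m x y) * h2 (\<lambda>k\<in>{m..0}. (x k, y k)))"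
      unfolding h2_def cw ckw sum_distrib_right using m n path_density_nonneg[OF m(2)] cond_kernel_bounds[OF n]
      by (intro sum.cong) (auto simp: ennreal_mult mult.assoc)
    finally show "(\<Sum>x\<in>PiE {m..0} (\<lambda>_. UNIV). ennreal (path_density m x y) * h1 (\<lambda>k\<in>{m..0}. (x k, y k)))
        = (\<Sum>x\<in>PiE {m..0} (\<lambda>_. UNIV). ennreal (path_density m x y) * h2 (\<lambda>k\<in>{m..0}. (x k, y k)))" .
  qed
  also have "\<dots> = (\<integral>\<^sup>+\<omega>. h2 (\<lambda>k\<in>{m..0}. (coord_X k \<omega>, coord_Y k \<omega>)) \<partial>P)"
    by (rule nn_integral_window[OF m(2) h2, symmetric])
  also have "\<dots> = (\<integral>\<^sup>+\<omega>. ennreal (cond_kernel M g (\<lambda>k. coord_Y k \<omega>) n (coord_X (n - 1) \<omega>) z) * (\<Prod>j\<in>J. indicator (A j) (coord_Y j \<omega>)) \<partial>P)"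
    unfolding h2_def cw ckw using m n by simp
  finally show ?thesis by (simp add: coord_Y_def)
qed

lemma cond_kernel_at_X_measurable:
  assumes n: "n \<le> 0"
  shows "(\<lambda>\<omega>. cond_kernel M g (snd \<omega>) n (coord_X (n - 1) \<omega>) z) \<in> borel_measurable P"
proof -
  have "(\<lambda>\<omega>. cond_kernel M g (snd \<omega>) n u z) \<in> borel_measurable P" for u
    using coord_Y_measurable n by (intro cond_kernel_measurable) (auto simp: coord_Y_def[abs_def])
  then have "(\<lambda>\<omega>. \<Sum>u\<in>UNIV. (if coord_X (n - 1) \<omega> = u then 1 else 0) * cond_kernel M g (snd \<omega>) n u z)
      \<in> borel_measurable P"
    using n by (intro borel_measurable_sum borel_measurable_times
        measurable_compose[OF coord_X_measurable[of "n - 1"]]) auto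
  then show ?thesis by (simp add: if_distrib[of "\<lambda>t. t * _"] cong: if_cong)
qed

text \<open>
  As functions of \<open>C\<close>, both sides are finite measures on the space of observations, and such measures
  are determined by their values on cylinder sets.
\<close>

lemma smoothing_step:
  assumes n: "n \<le> 0" and C: "C \<in> sets path_Y"
  shows "(\<integral>\<^sup>+\<omega>. ennreal (if coord_X n \<omega> = z then 1 else 0) * indicator (snd -` C \<inter> space P) \<omega> \<partial>P)
    = (\<integral>\<^sup>+\<omega>. ennreal (cond_kernel M g (snd \<omega>) n (coord_X (n - 1) \<omega>) z) * indicator (snd -` C \<inter> space P) \<omega> \<partial>P)"
proof -
  let ?f1 = "\<lambda>\<omega>. ennreal (if coord_X n \<omega> = z then 1 else 0)"
  let ?f2 = "\<lambda>\<omega>. ennreal (cond_kernel M g (snd \<omega>) n (coord_X (n - 1) \<omega>) z)"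
  have f: "?f1 \<in> borel_measurable P" "?f2 \<in> borel_measurable P"
    using n cond_kernel_at_X_measurable[OF n] by (auto intro!: measurable_compose[OF coord_X_measurable])
  have em: "emeasure (distr (density P f) path_Y snd) D = (\<integral>\<^sup>+\<omega>. f \<omega> * indicator (snd -` D \<inter> space P) \<omega> \<partial>P)"
    if "D \<in> sets path_Y" "f \<in> borel_measurable P" for D f
  proof -
    have "snd -` D \<inter> space P \<in> sets P" using that by measurable
    then show ?thesis using that by (subst emeasure_distr) (auto simp: emeasure_density)
  qed
  have "distr (density P ?f1) path_Y snd = distr (density P ?f2) path_Y snd"
  proof (rule measure_eqI_PiM_infinite[where I = "{..0}" and M = "\<lambda>_. borel"])
    show "sets (distr (density P ?f1) path_Y snd) = sets (PiM {..0} (\<lambda>_. borel))"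
      "sets (distr (density P ?f2) path_Y snd) = sets (PiM {..0} (\<lambda>_. borel))"
      by (simp_all add: path_Y_def)
    show "finite_measure (distr (density P ?f1) path_Y snd)"
    proof
      have "(\<integral>\<^sup>+\<omega>. ?f1 \<omega> * indicator (snd -` space path_Y \<inter> space P) \<omega> \<partial>P) \<le> (\<integral>\<^sup>+\<omega>. 1 \<partial>P)"
        by (intro nn_integral_mono) (auto simp: indicator_def)
      also have "\<dots> < top" by (simp add: emeasure_space_1)
      finally show "emeasure (distr (density P ?f1) path_Y snd) (space (distr (density P ?f1) path_Y snd)) \<noteq> \<infinity>"
        using f by (simp add: em)
    qed
    fix A :: "int \<Rightarrow> 'f set" and J :: "int set"
    assume J: "finite J" "J \<subseteq> {..0}" and A: "\<And>i. i \<in> J \<Longrightarrow> A i \<in> sets borel"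
    let ?C = "prod_emb {..0} (\<lambda>_. borel) J (Pi\<^sub>E J A) :: (int \<Rightarrow> 'f) set"
    have C: "?C \<in> sets path_Y"
      unfolding path_Y_def using J A by (intro sets_PiM_I) auto
    have ind: "indicator (snd -` ?C \<inter> space P) \<omega> = (\<Prod>j\<in>J. indicator (A j) (coord_Y j \<omega>) :: ennreal)"
      if "\<omega> \<in> space P" for \<omega>
    proof -
      have "snd \<omega> \<in> space path_Y" using that measurable_space[OF snd_measurable] by blast
      then have "\<omega> \<in> snd -` ?C \<inter> space P \<longleftrightarrow> (\<forall>j\<in>J. coord_Y j \<omega> \<in> A j)"
        using that by (auto simp: prod_emb_def path_Y_def space_PiM coord_Y_def PiE_iff)
      then show ?thesis
        using J by (auto simp: indicator_def)
    qed
    show "emeasure (distr (density P ?f1) path_Y snd) ?C = emeasure (distr (density P ?f2) path_Y snd) ?C"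
      using f C smoothing_step_cylinder[OF n J A, where z = z] by (simp add: em ind cong: nn_integral_cong)
  qed
  then show ?thesis using em[OF C f(1)] em[OF C f(2)] by simp
qed

lemma sets_sigma_Y:
  "sets (sigma_Y P) = sigma_sets (space P) {coord_Y n -` B \<inter> space P | n B. n \<le> 0 \<and> B \<in> sets borel}"
  unfolding sigma_Y_def by (rule sets_measure_of) auto

lemma sigma_Y_subalgebra: "subalgebra P (sigma_Y P)"
proof -
  have "{coord_Y n -` B \<inter> space P | n B. n \<le> 0 \<and> B \<in> sets borel} \<subseteq> sets P"
    using coord_Y_measurable by (auto intro: measurable_sets)
  then show ?thesis
    unfolding subalgebra_def sets_sigma_Y
    by (auto simp: sigma_Y_def space_measure_of_conv dest: sets.sigma_sets_subset)
qed

sublocale FY: finite_measure_subalgebra P "sigma_Y P"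
  by unfold_locales (rule sigma_Y_subalgebra)

lemma sigma_Y_sets_vimage:
  assumes "A \<in> sets (sigma_Y P)"
  shows "\<exists>C\<in>sets path_Y. A = snd -` C \<inter> space P"
proof -
  let ?V = "vimage_algebra (space P) snd (path_Y :: (int \<Rightarrow> 'f) measure)"
  have snd: "snd \<in> ?V \<rightarrow>\<^sub>M path_Y"
    using measurable_space[OF snd_measurable] by (intro measurable_vimage_algebra1) auto
  have "{coord_Y n -` B \<inter> space P | n B. n \<le> 0 \<and> B \<in> sets borel} \<subseteq> sets ?V"
  proof clarify
    fix n :: int and B :: "'f set" assume n: "n \<le> 0" and B: "B \<in> sets borel"
    have "(\<lambda>y. y n) \<in> path_Y \<rightarrow>\<^sub>M (borel :: 'f measure)"
      unfolding path_Y_def using n by (intro measurable_component_singleton) simp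
    from measurable_sets[OF measurable_compose[OF snd this] B]
    show "coord_Y n -` B \<inter> space P \<in> sets ?V" by (simp add: coord_Y_def[abs_def])
  qed
  then have "sets (sigma_Y P) \<subseteq> sets ?V"
    unfolding sets_sigma_Y using sets.sigma_sets_subset[of _ ?V] by simp
  with assms have "A \<in> sets ?V" by blast
  then show ?thesis
    using measurable_space[OF snd_measurable] by (subst (asm) sets_vimage_algebra2) auto
qed

lemma coord_Y_measurable_sigma_Y:
  assumes "n \<le> 0"
  shows "(\<lambda>\<omega>. snd \<omega> n) \<in> sigma_Y P \<rightarrow>\<^sub>M borel"
proof (rule measurableI)
  fix B :: "'f set" assume "B \<in> sets borel"
  then have "coord_Y n -` B \<inter> space P \<in> sets (sigma_Y P)"
    unfolding sets_sigma_Y using assms by (auto intro!: sigma_sets.Basic)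
  then show "(\<lambda>\<omega>. snd \<omega> n) -` B \<inter> space (sigma_Y P) \<in> sets (sigma_Y P)"
    by (simp add: coord_Y_def[abs_def] sigma_Y_def space_measure_of_conv)
qed simp

definition state_indicator :: "int \<Rightarrow> 'e \<Rightarrow> (int \<Rightarrow> 'e) \<times> (int \<Rightarrow> 'f) \<Rightarrow> real" where
  "state_indicator n z \<omega> = (if coord_X n \<omega> = z then 1 else 0)"

lemma state_indicator_measurable:
  "n \<le> 0 \<Longrightarrow> state_indicator n z \<in> borel_measurable P"
  unfolding state_indicator_def[abs_def] by (intro measurable_compose[OF coord_X_measurable]) auto

lemma state_indicator_integrable:
  assumes "n \<le> 0"
  shows "integrable P (state_indicator n z)"
  by (rule integrable_const_bound[where B = 1])
    (auto simp: state_indicator_measurable assms, auto simp: state_indicator_def)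

text \<open>
  The conditional law of the state at time \<open>n\<close> is called smoothed, since it takes into account the
  observations after time \<open>n\<close> as well as those before.
\<close>

definition smoothed :: "int \<Rightarrow> 'e \<Rightarrow> (int \<Rightarrow> 'e) \<times> (int \<Rightarrow> 'f) \<Rightarrow> real" where
  "smoothed n z = real_cond_exp P (sigma_Y P) (state_indicator n z)"

text \<open>
  Tested on events of the observations, the indicator of \<open>X\<^sub>n = z\<close> may be replaced by the
  conditional kernel evaluated at the state of time \<open>n - 1\<close>.  The latter is a finite sum of indicators with
  coefficients that are functions of the observations and so can be taken out of the conditional
  expectation.
\<close>

lemma smoothed_step:
  assumes n: "n \<le> 0"
  shows "AE \<omega> in P. (\<Sum>u\<in>UNIV. smoothed (n - 1) u \<omega> * cond_kernel M g (snd \<omega>) n u z) = smoothed n z \<omega>"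
proof -
  let ?k = "\<lambda>u \<omega>. cond_kernel M g (snd \<omega>) n u z"
  let ?f = "\<lambda>\<omega>. cond_kernel M g (snd \<omega>) n (coord_X (n - 1) \<omega>) z"
  have n1: "n - 1 \<le> 0" using n by simp
  have k_F: "?k u \<in> borel_measurable (sigma_Y P)" for u
    using n by (intro cond_kernel_measurable coord_Y_measurable_sigma_Y) auto
  then have k_P: "?k u \<in> borel_measurable P" for u
    by (rule measurable_from_subalg[OF sigma_Y_subalgebra])
  have f_int: "integrable P ?f"
    by (rule integrable_const_bound[where B = 1])
      (use cond_kernel_at_X_measurable[OF n] cond_kernel_bounds[OF n] in auto)
  have prod_int: "integrable P (\<lambda>\<omega>. ?k u \<omega> * state_indicator (n - 1) u \<omega>)" for u
  proof (rule integrable_const_bound[where B = 1])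
    show "AE \<omega> in P. norm (?k u \<omega> * state_indicator (n - 1) u \<omega>) \<le> 1"
      using cond_kernel_bounds[OF n] by (auto simp: state_indicator_def)
    show "(\<lambda>\<omega>. ?k u \<omega> * state_indicator (n - 1) u \<omega>) \<in> borel_measurable P"
      by (intro borel_measurable_times k_P state_indicator_measurable n1)
  qed
  have AE1: "AE \<omega> in P. real_cond_exp P (sigma_Y P) (state_indicator n z) \<omega>
      = real_cond_exp P (sigma_Y P) ?f \<omega>"
  proof (rule FY.real_cond_exp_charact)
    fix A assume A: "A \<in> sets (sigma_Y P)"
    then obtain C where C: "C \<in> sets path_Y" "A = snd -` C \<inter> space P"
      using sigma_Y_sets_vimage by blast
    have A_P: "A \<in> sets P" using A sigma_Y_subalgebra by (auto simp: subalgebra_def)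
    have int: "(\<integral>\<omega>\<in>A. q \<omega> \<partial>P) = enn2real (\<integral>\<^sup>+\<omega>. ennreal (q \<omega>) * indicator A \<omega> \<partial>P)"
      if "q \<in> borel_measurable P" "\<And>\<omega>. 0 \<le> q \<omega>" for q
      unfolding set_lebesgue_integral_def using that A_P
      by (subst integral_eq_nn_integral)
        (auto simp: ennreal_mult' ennreal_indicator mult.commute intro!: arg_cong[where f=enn2real] nn_integral_cong)
    have "(\<integral>\<omega>\<in>A. state_indicator n z \<omega> \<partial>P) = (\<integral>\<omega>\<in>A. ?f \<omega> \<partial>P)"
      using smoothing_step[OF n C(1), of z] state_indicator_measurable[OF n, of z]
        cond_kernel_at_X_measurable[OF n, of z] cond_kernel_bounds(1)[OF n]
      by (subst (1 2) int) (auto simp: C(2) state_indicator_def)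
    also have "\<dots> = (\<integral>\<omega>\<in>A. real_cond_exp P (sigma_Y P) ?f \<omega> \<partial>P)"
      by (rule FY.real_cond_exp_intA[OF f_int A])
    finally show "(\<integral>\<omega>\<in>A. state_indicator n z \<omega> \<partial>P) = (\<integral>\<omega>\<in>A. real_cond_exp P (sigma_Y P) ?f \<omega> \<partial>P)" .
  qed (use state_indicator_integrable[OF n] FY.real_cond_exp_int(1)[OF f_int] in auto)
  have f_eq: "?f = (\<lambda>\<omega>. \<Sum>u\<in>UNIV. ?k u \<omega> * state_indicator (n - 1) u \<omega>)"
    by (simp add: state_indicator_def if_distrib[of "\<lambda>t. _ * t"] cong: if_cong)
  have AE2: "AE \<omega> in P. real_cond_exp P (sigma_Y P) (\<lambda>\<omega>. \<Sum>u\<in>UNIV. ?k u \<omega> * state_indicator (n - 1) u \<omega>) \<omega>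
      = (\<Sum>u\<in>UNIV. real_cond_exp P (sigma_Y P) (\<lambda>\<omega>. ?k u \<omega> * state_indicator (n - 1) u \<omega>) \<omega>)"
    by (rule FY.real_cond_exp_sum) (rule prod_int)
  have AE3: "AE \<omega> in P. \<forall>u\<in>UNIV. real_cond_exp P (sigma_Y P) (\<lambda>\<omega>. ?k u \<omega> * state_indicator (n - 1) u \<omega>) \<omega>
      = ?k u \<omega> * smoothed (n - 1) u \<omega>"
    unfolding smoothed_def
    by (intro AE_finite_allI FY.real_cond_exp_mult k_F state_indicator_measurable n1 prod_int) auto
  show ?thesis
    using AE1[unfolded f_eq] AE2 AE3
    by eventually_elim (simp add: smoothed_def[of n] mult.commute)
qed

lemma smoothed_set:
  assumes n: "n \<le> 0"
  shows "AE \<omega> in P. \<forall>A. real_cond_exp P (sigma_Y P) (indicator {\<omega>' \<in> space P. coord_X n \<omega>' \<in> A}) \<omega>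
    = (\<Sum>z\<in>A. smoothed n z \<omega>)"
proof -
  have "AE \<omega> in P. real_cond_exp P (sigma_Y P) (indicator {\<omega>' \<in> space P. coord_X n \<omega>' \<in> A}) \<omega>
    = (\<Sum>z\<in>A. smoothed n z \<omega>)" for A
  proof -
    have meas: "(\<lambda>\<omega>. \<Sum>z\<in>A. state_indicator n z \<omega>) \<in> borel_measurable P"
      using state_indicator_measurable[OF n] by (intro borel_measurable_sum)
    have eq: "(\<Sum>z\<in>A. state_indicator n z \<omega>) = indicator {\<omega>' \<in> space P. coord_X n \<omega>' \<in> A} \<omega>"
      if "\<omega> \<in> space P" for \<omega>
      using that by (auto simp: state_indicator_def indicator_def)
    have "(indicator {\<omega>' \<in> space P. coord_X n \<omega>' \<in> A} :: _ \<Rightarrow> real) \<in> borel_measurable P"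
      by (rule iffD1[OF measurable_cong[OF eq] meas])
    then have "AE \<omega> in P. real_cond_exp P (sigma_Y P) (indicator {\<omega>' \<in> space P. coord_X n \<omega>' \<in> A}) \<omega>
        = real_cond_exp P (sigma_Y P) (\<lambda>\<omega>. \<Sum>z\<in>A. state_indicator n z \<omega>) \<omega>"
      using meas eq by (intro FY.real_cond_exp_cong) auto
    moreover have "AE \<omega> in P. real_cond_exp P (sigma_Y P) (\<lambda>\<omega>. \<Sum>z\<in>A. state_indicator n z \<omega>) \<omega>
        = (\<Sum>z\<in>A. smoothed n z \<omega>)"
      unfolding smoothed_def by (intro FY.real_cond_exp_sum state_indicator_integrable n)
    ultimately show ?thesis by eventually_elim simp
  qed
  then have "AE \<omega> in P. \<forall>A\<in>UNIV. real_cond_exp P (sigma_Y P) (indicator {\<omega>' \<in> space P. coord_X n \<omega>' \<in> A}) \<omega>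
    = (\<Sum>z\<in>A. smoothed n z \<omega>)"
    by (intro AE_finite_allI) auto
  then show ?thesis by simp
qed

lemma smoothed_absolute_probs:
  "AE \<omega> in P. (\<lambda>n\<in>{..0}. \<lambda>z. smoothed n z \<omega>) \<in> absolute_probs (cond_kernel M g (snd \<omega>))"
proof -
  have nonneg: "AE \<omega> in P. \<forall>n\<in>{..0}. \<forall>z\<in>UNIV. 0 \<le> smoothed n z \<omega>"
    unfolding smoothed_def
    by (intro AE_ball_countable' AE_finite_allI FY.real_cond_exp_pos)
      (auto simp: state_indicator_measurable, auto simp: state_indicator_def)
  have sum1: "AE \<omega> in P. \<forall>n\<in>{..0}. (\<Sum>z\<in>UNIV. smoothed n z \<omega>) = 1"
  proof (intro AE_ball_countable')
    fix n :: int assume "n \<in> {..0}"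
    then have n: "n \<le> 0" by simp
    have sum: "AE \<omega> in P. real_cond_exp P (sigma_Y P) (\<lambda>\<omega>. \<Sum>z\<in>UNIV. state_indicator n z \<omega>) \<omega>
        = (\<Sum>z\<in>UNIV. smoothed n z \<omega>)"
      unfolding smoothed_def by (intro FY.real_cond_exp_sum state_indicator_integrable n)
    have one: "(\<lambda>\<omega>. \<Sum>z\<in>UNIV. state_indicator n z \<omega>) = (\<lambda>_. 1)"
      by (simp add: state_indicator_def)
    have "AE \<omega> in P. real_cond_exp P (sigma_Y P) (\<lambda>_. 1) \<omega> = 1"
      by (intro FY.real_cond_exp_F_meas) auto
    with sum[unfolded one] show "AE \<omega> in P. (\<Sum>z\<in>UNIV. smoothed n z \<omega>) = 1"
      by eventually_elim simp
  qed auto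
  have step: "AE \<omega> in P. \<forall>n\<in>{..0}. \<forall>z\<in>UNIV.
      (\<Sum>u\<in>UNIV. smoothed (n - 1) u \<omega> * cond_kernel M g (snd \<omega>) n u z) = smoothed n z \<omega>"
    by (intro AE_ball_countable' AE_finite_allI smoothed_step) auto
  show ?thesis
    using nonneg sum1 step
    by eventually_elim (auto simp: absolute_probs_def prob_vector_def)
qed

end

section \<open>Coalescence of the conditional chains\<close>

lemma coupling_kernel_random_flow:
  assumes M: "\<forall>n\<le>0. markov_kernel (M n)" and g: "\<forall>n\<le>0. \<forall>x y. 0 \<le> g n x y"
    and Q: "coupling_kernel M g Q" and y: "y \<in> space path_Y"
  shows "random_flow (Q y) (cond_kernel M g y)"
proof -
  have "Q \<in> measurable path_Y (prob_algebra coupling_space)"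
    using Q by (simp add: coupling_kernel_def)
  then have "Q y \<in> space (prob_algebra coupling_space)"
    using y by (rule measurable_space)
  then interpret prob_space "Q y" by (simp add: space_prob_algebra)
  show ?thesis
    using Q y markov_cond_kernel[OF M g] by unfold_locales (auto simp: coupling_kernel_def)
qed

theorem proposition6:
  fixes M :: "int \<Rightarrow> 'e::finite \<Rightarrow> 'e \<Rightarrow> real"
    and g :: "int \<Rightarrow> 'e \<Rightarrow> 'f::polish_space \<Rightarrow> real"
    and \<psi> :: "'f measure"
    and \<pi> :: "int \<Rightarrow> 'e \<Rightarrow> real"
    and P :: "((int \<Rightarrow> 'e) \<times> (int \<Rightarrow> 'f)) measure"
    and Q :: "(int \<Rightarrow> 'f) \<Rightarrow> (int \<Rightarrow> 'e \<Rightarrow> 'e) measure"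
  assumes M: "\<forall>n\<le>0. markov_kernel (M n)"
    and \<psi>: "sets \<psi> = sets borel" "sigma_finite_measure \<psi>"
    and g_meas: "\<forall>n\<le>0. \<forall>x. g n x \<in> borel_measurable borel"
    and g_nonneg: "\<forall>n\<le>0. \<forall>x y. 0 \<le> g n x y"
    and G: "\<forall>n\<le>0. \<forall>x. prob_space (density \<psi> (\<lambda>y. ennreal (g n x y)))"
    and \<pi>: "\<pi> \<in> absolute_probs M"
    and P: "hmm_measure M g \<psi> \<pi> P"
    and Q: "coupling_kernel M g Q"
  shows "(\<forall>y\<in>space path_Y.
      ((\<forall>k\<le>0. \<forall>x x' z.
          ((\<lambda>n. backward_prod (cond_kernel M g y) n k x z
                - backward_prod (cond_kernel M g y) n k x' z) \<longlongrightarrow> 0) at_bot)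
        \<longleftrightarrow> coalescence (Q y))
    \<and> (card (absolute_probs (cond_kernel M g y)) = 1 \<longleftrightarrow> coalescence (Q y))
    \<and> ((\<forall>k\<le>0. ((\<lambda>n. dobrushin (backward_prod (cond_kernel M g y) n k)) \<longlongrightarrow> 0) at_bot)
        \<longleftrightarrow> coalescence (Q y))
    \<and> ((\<exists>m :: nat \<Rightarrow> int. (\<forall>i. m i \<le> 0) \<and> (\<forall>i. m (Suc i) < m i) \<and>
          filterlim (\<lambda>N. \<Sum>i<N. 1 - dobrushin (backward_prod (cond_kernel M g y) (m (Suc i)) (m i)))
            at_top sequentially)
        \<longleftrightarrow> coalescence (Q y))
    \<and> (coalescence (Q y) \<longrightarrow>
        (\<exists>\<pi>y. absolute_probs (cond_kernel M g y) = {\<pi>y} \<and>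
          (\<forall>n\<le>0. \<forall>x A. \<P>(\<xi> in Q y. coal_map n \<xi> x \<in> A) = (\<Sum>z\<in>A. \<pi>y n z)))))
  \<and> ((AE y in distr P path_Y snd. coalescence (Q y)) \<longrightarrow>
      (\<forall>n\<le>0. \<forall>x. AE \<omega> in P. \<forall>A.
        \<P>(\<xi> in Q (snd \<omega>). coal_map n \<xi> x \<in> A)
          = real_cond_exp P (sigma_Y P) (indicator {\<omega>' \<in> space P. coord_X n \<omega>' \<in> A}) \<omega>))"
proof -
  have flow: "random_flow (Q y) (cond_kernel M g y)" if "y \<in> space path_Y" for y
    using coupling_kernel_random_flow[OF M g_nonneg Q that] .
  have K: "\<forall>n\<le>0. markov_kernel (cond_kernel M g y n)" for y
    by (rule markov_cond_kernel[OF M g_nonneg])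
  have merge: "rows_merge (cond_kernel M g y) \<longleftrightarrow> coalescence (Q y)" if "y \<in> space path_Y" for y
    using random_flow.rows_merge_imp_coalescence[OF flow[OF that]]
      random_flow.coalescence_imp_rows_merge[OF flow[OF that]] by blast
  have unique: "\<exists>\<pi>y. absolute_probs (cond_kernel M g y) = {\<pi>y} \<and>
          (\<forall>n\<le>0. \<forall>x A. \<P>(\<xi> in Q y. coal_map n \<xi> x \<in> A) = (\<Sum>z\<in>A. \<pi>y n z))"
    if y: "y \<in> space path_Y" and coal: "coalescence (Q y)" for y
  proof -
    obtain \<pi>y where \<pi>y: "absolute_probs (cond_kernel M g y) = {\<pi>y}"
      using rows_merge_imp_unique[OF K] merge[OF y] coal by blast
    then show ?thesis
      using random_flow.prob_coal_map[OF flow[OF y] coal, of \<pi>y] by blast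
  qed
  interpret hidden_markov M g \<psi> \<pi> P
    using M \<psi> g_meas g_nonneg \<pi> P by (rule hidden_markov.intro)
  have smoothing: "AE \<omega> in P. \<forall>A. \<P>(\<xi> in Q (snd \<omega>). coal_map n \<xi> x \<in> A)
          = real_cond_exp P (sigma_Y P) (indicator {\<omega>' \<in> space P. coord_X n \<omega>' \<in> A}) \<omega>"
    if AE_coal: "AE y in distr P path_Y snd. coalescence (Q y)" and n: "n \<le> 0" for n x
    using AE_distrD[OF snd_measurable AE_coal] smoothed_absolute_probs smoothed_set[OF n] AE_space
  proof eventually_elim
    case (elim \<omega>)
    have y: "snd \<omega> \<in> space path_Y"
      using elim(4) measurable_space[OF snd_measurable] by blast
    obtain \<pi>y where \<pi>y: "absolute_probs (cond_kernel M g (snd \<omega>)) = {\<pi>y}"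
      "\<And>A. \<P>(\<xi> in Q (snd \<omega>). coal_map n \<xi> x \<in> A) = (\<Sum>z\<in>A. \<pi>y n z)"
      using unique[OF y elim(1)] n by blast
    have "\<pi>y n z = smoothed n z \<omega>" for z
      using elim(2) \<pi>y(1) n by (auto dest!: singletonD)
    then show ?case
      using elim(3) \<pi>y(2) by simp
  qed
  show ?thesis
    unfolding rows_merge_def[symmetric] divergent_blocks_def[symmetric]
  proof (intro conjI ballI impI allI)
    fix y :: "int \<Rightarrow> 'f" assume y: "y \<in> space path_Y"
    show "rows_merge (cond_kernel M g y) \<longleftrightarrow> coalescence (Q y)"
      by (rule merge[OF y])
    show "card (absolute_probs (cond_kernel M g y)) = 1 \<longleftrightarrow> coalescence (Q y)"
    proof
      assume "card (absolute_probs (cond_kernel M g y)) = 1"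
      then obtain \<pi>y where "absolute_probs (cond_kernel M g y) = {\<pi>y}"
        by (auto simp: card_1_singleton_iff)
      then show "coalescence (Q y)"
        using unique_imp_rows_merge[OF K] merge[OF y] by blast
    next
      assume "coalescence (Q y)"
      then show "card (absolute_probs (cond_kernel M g y)) = 1"
        using unique[OF y] by auto
    qed
    show "(\<forall>k\<le>0. ((\<lambda>n. dobrushin (backward_prod (cond_kernel M g y) n k)) \<longlongrightarrow> 0) at_bot)
        \<longleftrightarrow> coalescence (Q y)"
      using merge[OF y] by (simp only: rows_merge_iff_dobrushin)
    show "divergent_blocks (cond_kernel M g y) \<longleftrightarrow> coalescence (Q y)"
      using merge[OF y] rows_merge_imp_divergent_blocks divergent_blocks_imp_rows_merge[OF K] by blast
  qed (rule unique smoothing; assumption)+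
qed

end
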